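(* Let $a>0$ and $R_0>0$, and let $\Omega(R_0)\subset\mathbb{H}^2(-a^2)$ be the exterior of the closed geodesic ball of radius $R_0$. There exists a nontrivial solution $(u,p)$ (i.e. $u\not\equiv 0$), where $u\in H^1_0(\Omega(R_0))$ is a 1-form and $p$ is a function on $\Omega(R_0)$, of the steady Stokes system $$-\triangle u+2a^2u+\mathrm{d}p=0,\qquad \mathrm{d}^*u=0\quad\text{on }\Omega(R_0),\qquad u\big|_{\partial\Omega(R_0)}=0,$$ such that $\int_{\Omega(R_0)}|\nabla u|^2<\infty$ and $p\in L^2_{loc}(\Omega(R_0))$.
   Context: $\mathbb{H}^2(-a^2)$ is the hyperbolic plane (complete, simply connected Riemannian surface of constant curvature $-a^2$) with metric $g$, Riemannian volume, and Levi-Civita connection $\nabla$. Fix a base point $O$, let $\rho(O,x)$ be the geodesic distance, and $\Omega(R_0)=\{x:\rho(O,x)>R_0\}$. $\mathrm{d}^*$ is the formal $L^2$ adjoint of $\mathrm{d}$ (so $\mathrm{d}^*u=-\mathrm{div}\,u$ on 1-forms) and $-\triangle=\mathrm{d}\mathrm{d}^*+\mathrm{d}^*\mathrm{d}$ is the Hodge Laplacian. For an open set $U$, $H^1_0(U)$ is the closure of the smooth compactly supported 1-forms on $U$ in the norm $(\|\varphi\|_{L^2}^2+\|\nabla\varphi\|_{L^2}^2)^{1/2}$. The equations are understood in the sense of distributions on $\Omega(R_0)$, and the boundary condition is understood as $u\in H^1_0(\Omega(R_0))$. *)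

theory Defs
  imports "HOL-Analysis.Analysis"
begin

definition partial :: "'n::finite \<Rightarrow> (real^'n \<Rightarrow> real) \<Rightarrow> real^'n \<Rightarrow> real" where
  "partial i f x = frechet_derivative f (at x) (axis i 1)"

primrec Ck_on :: "nat \<Rightarrow> (real^'n::finite \<Rightarrow> real) \<Rightarrow> (real^'n) set \<Rightarrow> bool" where
  "Ck_on 0 f U \<longleftrightarrow> continuous_on U f"
| "Ck_on (Suc k) f U \<longleftrightarrow> (\<forall>x\<in>U. f differentiable (at x)) \<and> (\<forall>i. Ck_on k (partial i f) U)"

definition smooth_on :: "(real^'n::finite \<Rightarrow> real) \<Rightarrow> (real^'n) set \<Rightarrow> bool" where
  "smooth_on f U \<longleftrightarrow> (\<forall>k. Ck_on k f U)"

text \<open>Elements of \<open>C\<^sub>c\<^sup>\<infinity>(U)\<close>, for functions and for 1-forms, are taken to be extended by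
  zero to the whole coordinate space.\<close>

definition test_function :: "(real^'n::finite) set \<Rightarrow> (real^'n \<Rightarrow> real) \<Rightarrow> bool" where
  "test_function U \<eta> \<longleftrightarrow> smooth_on \<eta> UNIV \<and>
     compact (closure {x. \<eta> x \<noteq> 0}) \<and> closure {x. \<eta> x \<noteq> 0} \<subseteq> U"

definition test_form :: "(real^'n::finite) set \<Rightarrow> (real^'n \<Rightarrow> real^'n) \<Rightarrow> bool" where
  "test_form U \<phi> \<longleftrightarrow> (\<forall>i. test_function U (\<lambda>x. \<phi> x $ i))"

text \<open>A metric on an open set of \<open>\<real>\<^sup>n\<close> is the field \<open>G\<close> of its Gram matrices \<open>g\<^sub>i\<^sub>j\<close>.
  A 1-form is given by its components \<open>u\<^sub>i\<close>, a covariant 2-tensor by its components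
  \<open>A\<^sub>i\<^sub>j = A $ i $ j\<close>, and a 2-form by its antisymmetric component matrix.\<close>

type_synonym 'n metric = "real^'n \<Rightarrow> real^'n^'n"
type_synonym 'n oneform = "real^'n \<Rightarrow> real^'n"
type_synonym 'n tensor2 = "real^'n \<Rightarrow> real^'n^'n"

definition ginv :: "'n::finite metric \<Rightarrow> real^'n \<Rightarrow> 'n \<Rightarrow> 'n \<Rightarrow> real" where
  "ginv G x i j = matrix_inv (G x) $ i $ j"

definition vol_density :: "'n::finite metric \<Rightarrow> real^'n \<Rightarrow> real" where
  "vol_density G x = sqrt (det (G x))"

definition vol :: "'n::finite metric \<Rightarrow> (real^'n) set \<Rightarrow> (real^'n) measure" where
  "vol G U = density (lebesgue_on U) (\<lambda>x. ennreal (vol_density G x))"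

definition christoffel :: "'n::finite metric \<Rightarrow> 'n \<Rightarrow> 'n \<Rightarrow> 'n \<Rightarrow> real^'n \<Rightarrow> real" where
  "christoffel G k i j x = (1/2) * (\<Sum>l\<in>UNIV. ginv G x k l *
     (partial i (\<lambda>y. G y $ j $ l) x + partial j (\<lambda>y. G y $ i $ l) x
      - partial l (\<lambda>y. G y $ i $ j) x))"

text \<open>The component \<open>$ i $ j\<close> is \<open>(\<nabla>\<^sub>i u)\<^sub>j\<close>.\<close>

definition cov_deriv :: "'n::finite metric \<Rightarrow> 'n oneform \<Rightarrow> 'n tensor2" where
  "cov_deriv G u x = (\<chi> i j. partial i (\<lambda>y. u y $ j) x
     - (\<Sum>k\<in>UNIV. christoffel G k i j x * u x $ k))"

definition form_inner :: "'n::finite metric \<Rightarrow> real^'n \<Rightarrow> real^'n \<Rightarrow> real^'n \<Rightarrow> real" where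
  "form_inner G x \<alpha> \<beta> = (\<Sum>i\<in>UNIV. \<Sum>j\<in>UNIV. ginv G x i j * \<alpha> $ i * \<beta> $ j)"

definition tensor_inner :: "'n::finite metric \<Rightarrow> real^'n \<Rightarrow> real^'n^'n \<Rightarrow> real^'n^'n \<Rightarrow> real" where
  "tensor_inner G x A B = (\<Sum>i\<in>UNIV. \<Sum>j\<in>UNIV. \<Sum>k\<in>UNIV. \<Sum>l\<in>UNIV.
     ginv G x i k * ginv G x j l * A $ i $ j * B $ k $ l)"

definition curve_length :: "'n::finite metric \<Rightarrow> (real \<Rightarrow> real^'n) \<Rightarrow> real" where
  "curve_length G \<gamma> = integral {0..1} (\<lambda>t.
     sqrt (\<Sum>i\<in>UNIV. \<Sum>j\<in>UNIV. G (\<gamma> t) $ i $ j *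
       vector_derivative \<gamma> (at t) $ i * vector_derivative \<gamma> (at t) $ j))"

text \<open>The curves are \<open>C\<^sup>1\<close> up to the end points, so that the integrand above is continuous.
  (The library notion \<open>piecewise_C1_differentiable_on\<close> does not bound the derivative near
  the exceptional points; a curve of infinite length would then get length 0.)\<close>

definition geodesic_dist ::
    "'n::finite metric \<Rightarrow> (real^'n) set \<Rightarrow> real^'n \<Rightarrow> real^'n \<Rightarrow> real" where
  "geodesic_dist G M x y = Inf {curve_length G \<gamma> | \<gamma>.
     \<gamma> C1_differentiable_on {0..1} \<and> \<gamma> ` {0..1} \<subseteq> M \<and> \<gamma> 0 = x \<and> \<gamma> 1 = y}"

definition ext_deriv0 :: "(real^'n::finite \<Rightarrow> real) \<Rightarrow> 'n oneform" where
  "ext_deriv0 f x = (\<chi> i. partial i f x)"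

definition ext_deriv1 :: "'n::finite oneform \<Rightarrow> 'n tensor2" where
  "ext_deriv1 u x = (\<chi> i j. partial i (\<lambda>y. u y $ j) x - partial j (\<lambda>y. u y $ i) x)"

text \<open>Formal adjoints of the two operators above with respect to the Riemannian volume and the
  pointwise inner products \<open>g\<^sup>i\<^sup>j \<alpha>\<^sub>i \<beta>\<^sub>j\<close> on 1-forms and
  \<open>(1/2) g\<^sup>i\<^sup>k g\<^sup>j\<^sup>l \<alpha>\<^sub>i\<^sub>j \<beta>\<^sub>k\<^sub>l\<close> on 2-forms, in divergence form:
  \<open>d\<^sup>* u = - |g|\<^sup>-\<^sup>1\<^sup>/\<^sup>2 \<partial>\<^sub>i (|g|\<^sup>1\<^sup>/\<^sup>2 u\<^sup>i)\<close> and
  \<open>(d\<^sup>* \<omega>)\<^sup>j = - |g|\<^sup>-\<^sup>1\<^sup>/\<^sup>2 \<partial>\<^sub>i (|g|\<^sup>1\<^sup>/\<^sup>2 \<omega>\<^sup>i\<^sup>j)\<close>, the latter with its index lowered.\<close>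

definition codiff1 :: "'n::finite metric \<Rightarrow> 'n oneform \<Rightarrow> real^'n \<Rightarrow> real" where
  "codiff1 G u x = - (1 / vol_density G x) * (\<Sum>i\<in>UNIV.
     partial i (\<lambda>y. vol_density G y * (\<Sum>j\<in>UNIV. ginv G y i j * u y $ j)) x)"

definition codiff2 :: "'n::finite metric \<Rightarrow> 'n tensor2 \<Rightarrow> 'n oneform" where
  "codiff2 G \<omega> x = (\<chi> m. \<Sum>j\<in>UNIV. G x $ m $ j *
     (- (1 / vol_density G x) * (\<Sum>i\<in>UNIV.
       partial i (\<lambda>y. vol_density G y *
         (\<Sum>k\<in>UNIV. \<Sum>l\<in>UNIV. ginv G y i k * ginv G y j l * \<omega> y $ k $ l)) x)))"

definition neg_hodge_laplacian :: "'n::finite metric \<Rightarrow> 'n oneform \<Rightarrow> 'n oneform" where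
  "neg_hodge_laplacian G u x = ext_deriv0 (codiff1 G u) x + codiff2 G (ext_deriv1 u) x"

definition L2_form :: "'n::finite metric \<Rightarrow> (real^'n) set \<Rightarrow> 'n oneform \<Rightarrow> bool" where
  "L2_form G U u \<longleftrightarrow> u \<in> borel_measurable (lebesgue_on U) \<and>
     integrable (vol G U) (\<lambda>x. form_inner G x (u x) (u x))"

definition L2_tensor :: "'n::finite metric \<Rightarrow> (real^'n) set \<Rightarrow> 'n tensor2 \<Rightarrow> bool" where
  "L2_tensor G U A \<longleftrightarrow> A \<in> borel_measurable (lebesgue_on U) \<and>
     integrable (vol G U) (\<lambda>x. tensor_inner G x (A x) (A x))"

definition L2_loc :: "'n::finite metric \<Rightarrow> (real^'n) set \<Rightarrow> (real^'n \<Rightarrow> real) \<Rightarrow> bool" where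
  "L2_loc G U p \<longleftrightarrow> p \<in> borel_measurable (lebesgue_on U) \<and>
     (\<forall>K. compact K \<and> K \<subseteq> U \<longrightarrow> set_integrable (vol G U) K (\<lambda>x. (p x)\<^sup>2))"

definition L1_loc :: "(real^'n::finite) set \<Rightarrow> (real^'n \<Rightarrow> real) \<Rightarrow> bool" where
  "L1_loc U f \<longleftrightarrow> (\<forall>K. compact K \<and> K \<subseteq> U \<longrightarrow> set_integrable lebesgue K f)"

definition weak_partial ::
    "(real^'n::finite) set \<Rightarrow> 'n \<Rightarrow> (real^'n \<Rightarrow> real) \<Rightarrow> (real^'n \<Rightarrow> real) \<Rightarrow> bool" where
  "weak_partial U i f D \<longleftrightarrow> L1_loc U f \<and> L1_loc U D \<and>
     (\<forall>\<eta>. test_function U \<eta> \<longrightarrow>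
        (LINT x|lebesgue_on U. f x * partial i \<eta> x) = - (LINT x|lebesgue_on U. D x * \<eta> x))"

text \<open>\<open>W = \<nabla>u\<close> in the sense of distributions: \<open>\<partial>\<^sub>i u\<^sub>j = W\<^sub>i\<^sub>j + \<Gamma>\<^sup>k\<^sub>i\<^sub>j u\<^sub>k\<close>,
  cf. \<open>cov_deriv\<close>.\<close>

definition weak_cov_deriv ::
    "'n::finite metric \<Rightarrow> (real^'n) set \<Rightarrow> 'n oneform \<Rightarrow> 'n tensor2 \<Rightarrow> bool" where
  "weak_cov_deriv G U u W \<longleftrightarrow> (\<forall>i j. weak_partial U i (\<lambda>x. u x $ j)
     (\<lambda>x. W x $ i $ j + (\<Sum>k\<in>UNIV. christoffel G k i j x * u x $ k)))"

definition H1_norm ::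
    "'n::finite metric \<Rightarrow> (real^'n) set \<Rightarrow> 'n oneform \<Rightarrow> 'n tensor2 \<Rightarrow> real" where
  "H1_norm G U u W = sqrt ((LINT x|vol G U. form_inner G x (u x) (u x))
     + (LINT x|vol G U. tensor_inner G x (W x) (W x)))"

text \<open>The closure of the test forms, realised inside the \<open>L\<^sup>2\<close> forms whose distributional
  covariant derivative \<open>W\<close> is in \<open>L\<^sup>2\<close>.\<close>

definition H1_0 :: "'n::finite metric \<Rightarrow> (real^'n) set \<Rightarrow> 'n oneform set" where
  "H1_0 G U = {u. L2_form G U u \<and>
     (\<exists>W. weak_cov_deriv G U u W \<and> L2_tensor G U W \<and>
       (\<exists>\<phi> :: nat \<Rightarrow> 'n oneform. (\<forall>n. test_form U (\<phi> n)) \<and>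
         (\<lambda>n. H1_norm G U (\<lambda>x. \<phi> n x - u x) (\<lambda>x. cov_deriv G (\<phi> n) x - W x))
           \<longlonglongrightarrow> 0))}"

text \<open>\<open>-\<triangle>u + 2a\<^sup>2u + dp = 0\<close> on \<open>U\<close>, all operators being moved to the test form.\<close>

definition stokes_momentum ::
    "real \<Rightarrow> 'n::finite metric \<Rightarrow> (real^'n) set \<Rightarrow> 'n oneform \<Rightarrow> (real^'n \<Rightarrow> real) \<Rightarrow> bool" where
  "stokes_momentum a G U u p \<longleftrightarrow> (\<forall>\<phi>. test_form U \<phi> \<longrightarrow>
     (LINT x|vol G U. form_inner G x (u x) (neg_hodge_laplacian G \<phi> x))
     + 2 * a\<^sup>2 * (LINT x|vol G U. form_inner G x (u x) (\<phi> x))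
     + (LINT x|vol G U. p x * codiff1 G \<phi> x) = 0)"

definition weakly_coclosed ::
    "'n::finite metric \<Rightarrow> (real^'n) set \<Rightarrow> 'n oneform \<Rightarrow> bool" where
  "weakly_coclosed G U u \<longleftrightarrow> (\<forall>\<eta>. test_function U \<eta> \<longrightarrow>
     (LINT x|vol G U. form_inner G x (u x) (ext_deriv0 \<eta> x)) = 0)"

text \<open>Poincare disc model: the unit disc with
  \<open>g = 4 (dx\<^sub>1\<^sup>2 + dx\<^sub>2\<^sup>2) / (a\<^sup>2 (1 - |x|\<^sup>2)\<^sup>2)\<close>.\<close>

definition hyp_plane :: "(real^2) set" where
  "hyp_plane = ball 0 1"

definition hyp_metric :: "real \<Rightarrow> 2 metric" where
  "hyp_metric a x = mat (4 / (a\<^sup>2 * (1 - (norm x)\<^sup>2)\<^sup>2))"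

definition hyp_exterior :: "real \<Rightarrow> real^2 \<Rightarrow> real \<Rightarrow> (real^2) set" where
  "hyp_exterior a P R = {x \<in> hyp_plane. geodesic_dist (hyp_metric a) hyp_plane P x > R}"

end

theory Submission
  imports Defs
begin

text \<open>
The solution is explicit. Write \<open>u\<close> as the gradient of a stream function \<open>\<psi>\<close>, turned by a right angle. Taking the
curl of the momentum equation leaves \<open>\<Delta>(\<Delta> - 2 a\<^sup>2) \<psi> = 0\<close> for the Laplacian on functions, and \<open>\<psi>\<close> and its normal
derivative have to vanish on the boundary circle. In geodesic polar coordinates around the centre, that is, with
\<open>w = r exp (i \<theta>)\<close> in the disc model centred there, the angular mode \<open>cos 2\<theta>\<close> has three radial solutions that are
admissible at infinity: the harmonic functions \<open>r\<^sup>2\<close> and \<open>r\<^sup>-\<^sup>2\<close>, and \<open>(1 - r\<^sup>2)\<^sup>2 r\<^sup>-\<^sup>2\<close>, which solves \<open>\<Delta>\<psi> = 2 a\<^sup>2 \<psi>\<close>.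
In the Euclidean plane a growing harmonic function would be excluded; here the norm of 1-forms is conformally
invariant, so the differentials of both harmonic functions are square integrable near infinity. Three functions
and two boundary conditions leave a nontrivial combination. With \<open>k\<close> the Euclidean radius of the removed disc it is
\<open>\<psi> = (r\<^sup>2 - k\<^sup>2)\<^sup>2 r\<^sup>-\<^sup>2 cos 2\<theta>\<close>, the real part of \<open>(\<bar>w\<bar>\<^sup>2 - k\<^sup>2)\<^sup>2 / w\<^sup>2\<close>. The pressure is \<open>-2 a\<^sup>2\<close> times the harmonic
conjugate of the harmonic part of \<open>\<psi>\<close>.

For a general centre \<open>w\<close> is a Moebius function of the disc coordinate \<open>z\<close>, so \<open>E = 2 \<partial>\<psi>/\<partial>z\<close> and the pressure are
rational functions of \<open>z\<close> and its conjugate, and \<open>u = (Im E, Re E)\<close>. The strong equations reduce to Wirtinger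
derivatives (\<open>flow_divergence_free\<close>, \<open>flow_curl\<close>, \<open>flow_momentum\<close>).

Three things link this to the weak formulation. The geodesic exterior is the set \<open>k < \<bar>w\<bar> < 1\<close> with
\<open>k = tanh (a R/2)\<close>, since \<open>mob\<close> is an isometry and geodesic distance from the centre is \<open>(2/a) artanh \<bar>w\<bar>\<close>
(\<open>hyp_exterior_eq_exterior\<close>). Smooth solutions are distributional ones by integration by parts
(\<open>stokes_momentum_smooth\<close>, \<open>weakly_coclosed_smooth\<close>). Finally \<open>u\<close> is the limit in energy norm of test forms: it is
smooth up to both boundary circles and vanishes to first order on the inner one, so its products with cutoffs in
terms of a defining function of the domain converge to it (\<open>smooth_in_H1_0\<close>).
\<close>

section \<open>Functions of class \<open>C\<^sup>k\<close>\<close>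

lemma partial_eq:
  assumes "(f has_derivative D) (at x)"
  shows "partial i f x = D (axis i 1)"
  unfolding partial_def using frechet_derivative_at[OF assms] by simp

lemma differentiable_cong_open:
  fixes f g :: "real^'n \<Rightarrow> real"
  assumes "open U" "x \<in> U" "\<And>y. y \<in> U \<Longrightarrow> f y = g y" "f differentiable (at x)"
  shows "g differentiable (at x)"
proof -
  obtain D where "(f has_derivative D) (at x)" using assms(4) unfolding differentiable_def by blast
  then have "(g has_derivative D) (at x)"
    by (rule has_derivative_transform_within_open[OF _ assms(1,2)]) (simp add: assms(3))
  then show ?thesis unfolding differentiable_def by blast
qed

lemma partial_cong_open:
  fixes f g :: "real^'n \<Rightarrow> real"
  assumes "open U" "x \<in> U" "\<And>y. y \<in> U \<Longrightarrow> f y = g y"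
  shows "partial i f x = partial i g x"
proof -
  have "(f has_derivative D) (at x) \<longleftrightarrow> (g has_derivative D) (at x)" for D
    using has_derivative_transform_within_open[OF _ assms(1,2), of f D UNIV g]
      has_derivative_transform_within_open[OF _ assms(1,2), of g D UNIV f] assms(3) by auto
  then show ?thesis unfolding partial_def frechet_derivative_def by simp
qed

lemma partial_const [simp]: "partial i (\<lambda>x. c) x = 0"
  by (subst partial_eq[OF has_derivative_const]) simp

lemma partial_coord: "partial i (\<lambda>x. x $ j) x = (if i = j then 1 else 0)"
proof -
  have "((\<lambda>x. x $ j) has_derivative (\<lambda>x. x $ j)) (at x)"
    by (rule bounded_linear.has_derivative[OF bounded_linear_vec_nth has_derivative_ident])
  from partial_eq[OF this] show ?thesis by (simp add: axis_def)
qed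

lemma partial_add:
  assumes "f differentiable (at x)" "g differentiable (at x)"
  shows "partial i (\<lambda>y. f y + g y) x = partial i f x + partial i g x"
  using partial_eq[OF has_derivative_add[OF assms[unfolded frechet_derivative_works]]]
  by (simp add: partial_def)

lemma partial_mult:
  assumes "f differentiable (at x)" "g differentiable (at x)"
  shows "partial i (\<lambda>y. f y * g y) x = f x * partial i g x + partial i f x * g x"
  using partial_eq[OF has_derivative_mult[OF assms[unfolded frechet_derivative_works]]]
  by (simp add: partial_def)

lemma partial_cmult:
  assumes "f differentiable (at x)"
  shows "partial i (\<lambda>y. c * f y) x = c * partial i f x"
  using partial_mult[of "\<lambda>_. c" x f i] assms by simp

lemma partial_inverse:
  assumes "f differentiable (at x)" "f x \<noteq> 0"
  shows "partial i (\<lambda>y. inverse (f y)) x = (- 1) * (inverse (f x) * (inverse (f x) * partial i f x))"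
  using partial_eq[OF Deriv.has_derivative_inverse[OF assms(2) assms(1)[unfolded frechet_derivative_works]]]
  by (simp add: partial_def)

lemma partial_comp:
  assumes "f differentiable (at x)" "(h has_real_derivative d) (at (f x))"
  shows "partial i (\<lambda>y. h (f y)) x = d * partial i f x"
proof -
  have "((\<lambda>y. h (f y)) has_derivative (\<lambda>v. d * frechet_derivative f (at x) v)) (at x)"
    using has_derivative_compose[OF assms(1)[unfolded frechet_derivative_works]
        assms(2)[unfolded has_field_derivative_def]] .
  from partial_eq[OF this] show ?thesis by (simp add: partial_def)
qed

lemma Ck_on_Suc_imp: "Ck_on (Suc k) f U \<Longrightarrow> Ck_on k f U"
proof (induction k arbitrary: f)
  case 0
  then show ?case
    by (auto intro!: continuous_at_imp_continuous_on differentiable_imp_continuous_within)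
next
  case (Suc k)
  then show ?case by (metis Ck_on.simps(2))
qed

lemma Ck_on_subset: "Ck_on k f U \<Longrightarrow> V \<subseteq> U \<Longrightarrow> Ck_on k f V"
  by (induction k arbitrary: f) (auto intro: continuous_on_subset)

lemma Ck_on_cong:
  assumes "open U" "\<And>x. x \<in> U \<Longrightarrow> f x = g x"
  shows "Ck_on k f U \<longleftrightarrow> Ck_on k g U"
  using assms(2)
proof (induction k arbitrary: f g)
  case 0
  then show ?case by (auto intro!: continuous_on_cong)
next
  case (Suc k)
  have "Ck_on k (partial i f) U \<longleftrightarrow> Ck_on k (partial i g) U" for i
    by (rule Suc.IH) (use partial_cong_open[OF assms(1)] Suc.prems in blast)
  moreover have "(\<forall>x\<in>U. f differentiable (at x)) \<longleftrightarrow> (\<forall>x\<in>U. g differentiable (at x))"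
    using differentiable_cong_open[OF assms(1)] Suc.prems by metis
  ultimately show ?case by simp
qed

text \<open>Being of class \<open>C\<^sup>k\<close> is local. This is how products of a function on \<open>U\<close> with a test function are
recognised as test functions.\<close>

lemma Ck_on_Un:
  assumes "open U" "open V" "Ck_on k f U" "Ck_on k f V"
  shows "Ck_on k f (U \<union> V)"
  using assms(3,4)
  by (induction k arbitrary: f) (auto intro: continuous_on_open_Un[OF assms(1,2)])

lemma Ck_on_const:
  fixes U :: "(real^'n) set"
  shows "Ck_on k (\<lambda>x. c) U"
proof (induction k arbitrary: c)
  case (Suc k)
  have "partial i (\<lambda>x. c) = (\<lambda>x. 0)" for i :: 'n by auto
  then show ?case using Suc by simp
qed simp

lemma Ck_on_coord:
  fixes U :: "(real^'n) set"
  shows "Ck_on k (\<lambda>x. x $ j) U"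
proof (cases k)
  case (Suc m)
  have "partial i (\<lambda>x. x $ j) = (\<lambda>x. if i = j then 1 else 0)" for i :: 'n by (auto simp: partial_coord)
  moreover have "(\<lambda>x. x $ j) differentiable (at x)" for x :: "real^'n"
    using bounded_linear.has_derivative[OF bounded_linear_vec_nth has_derivative_ident]
    unfolding differentiable_def by blast
  ultimately show ?thesis using Suc by (simp add: Ck_on_const)
qed (simp add: continuous_intros)

lemma Ck_on_add:
  assumes "open U" "Ck_on k f U" "Ck_on k g U"
  shows "Ck_on k (\<lambda>x. f x + g x) U"
  using assms(2,3)
proof (induction k arbitrary: f g)
  case (Suc k)
  have "Ck_on k (partial i (\<lambda>x. f x + g x)) U" for i
    by (subst Ck_on_cong[OF assms(1), where g = "\<lambda>x. partial i f x + partial i g x"])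
      (use Suc in \<open>auto intro: partial_add\<close>)
  then show ?case using Suc by simp
qed (auto intro: continuous_intros)

lemma Ck_on_mult:
  assumes "open U" "Ck_on k f U" "Ck_on k g U"
  shows "Ck_on k (\<lambda>x. f x * g x) U"
  using assms(2,3)
proof (induction k arbitrary: f g)
  case (Suc k)
  note low = Ck_on_Suc_imp[OF Suc.prems(1)] Ck_on_Suc_imp[OF Suc.prems(2)]
  have "Ck_on k (partial i (\<lambda>x. f x * g x)) U" for i
    by (subst Ck_on_cong[OF assms(1), where g = "\<lambda>x. f x * partial i g x + partial i f x * g x"])
      (use Suc low in \<open>auto intro: partial_mult Ck_on_add[OF assms(1)]\<close>)
  then show ?case using Suc by simp
qed (auto intro: continuous_intros)

lemma Ck_on_inverse:
  assumes "open U" "Ck_on k f U" "\<And>x. x \<in> U \<Longrightarrow> f x \<noteq> 0"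
  shows "Ck_on k (\<lambda>x. inverse (f x)) U"
  using assms(2)
proof (induction k)
  case (Suc k)
  note low = Ck_on_Suc_imp[OF Suc.prems]
  have "Ck_on k (partial i (\<lambda>x. inverse (f x))) U" for i
  proof -
    have c: "Ck_on k (\<lambda>x. (- 1) * (inverse (f x) * (inverse (f x) * partial i f x))) U"
      by (intro Ck_on_mult[OF assms(1)] Ck_on_const) (use Suc low in auto)
    have e: "partial i (\<lambda>x. inverse (f x)) x
        = (- 1) * (inverse (f x) * (inverse (f x) * partial i f x))" if "x \<in> U" for x
      using partial_inverse[of f x i] Suc.prems that assms(3) by simp
    show ?thesis by (rule Ck_on_cong[OF assms(1), THEN iffD2, OF e c])
  qed
  then show ?case using Suc assms(3) by (auto intro: differentiable_inverse)
qed (use assms(3) in \<open>auto intro: continuous_intros\<close>)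

lemma smooth_on_const: "smooth_on (\<lambda>x. c) U"
  and smooth_on_coord: "smooth_on (\<lambda>x. x $ j) U"
  by (simp_all add: smooth_on_def Ck_on_const Ck_on_coord)

lemma smooth_on_add: "open U \<Longrightarrow> smooth_on f U \<Longrightarrow> smooth_on g U \<Longrightarrow> smooth_on (\<lambda>x. f x + g x) U"
  and smooth_on_mult: "open U \<Longrightarrow> smooth_on f U \<Longrightarrow> smooth_on g U \<Longrightarrow> smooth_on (\<lambda>x. f x * g x) U"
  and smooth_on_inverse:
    "open U \<Longrightarrow> smooth_on f U \<Longrightarrow> (\<And>x. x \<in> U \<Longrightarrow> f x \<noteq> 0) \<Longrightarrow> smooth_on (\<lambda>x. inverse (f x)) U"
  by (simp_all add: smooth_on_def Ck_on_add Ck_on_mult Ck_on_inverse)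

lemma smooth_on_uminus: "open U \<Longrightarrow> smooth_on f U \<Longrightarrow> smooth_on (\<lambda>x. - f x) U"
  using smooth_on_mult[OF _ smooth_on_const[of "-1"], of U f] by simp

lemma smooth_on_diff: "open U \<Longrightarrow> smooth_on f U \<Longrightarrow> smooth_on g U \<Longrightarrow> smooth_on (\<lambda>x. f x - g x) U"
  using smooth_on_add[OF _ _ smooth_on_uminus, of U f g] by simp

lemma smooth_on_power: "open U \<Longrightarrow> smooth_on f U \<Longrightarrow> smooth_on (\<lambda>x. f x ^ n) U"
  by (induction n) (simp_all add: smooth_on_const smooth_on_mult)

lemma smooth_on_divide:
  "open U \<Longrightarrow> smooth_on f U \<Longrightarrow> smooth_on g U \<Longrightarrow> (\<And>x. x \<in> U \<Longrightarrow> g x \<noteq> 0) \<Longrightarrow>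
    smooth_on (\<lambda>x. f x / g x) U"
  unfolding divide_inverse by (intro smooth_on_mult smooth_on_inverse) auto

lemma smooth_on_sum:
  "open U \<Longrightarrow> (\<And>i. i \<in> I \<Longrightarrow> smooth_on (f i) U) \<Longrightarrow> smooth_on (\<lambda>x. \<Sum>i\<in>I. f i x) U"
  by (induction I rule: infinite_finite_induct) (simp_all add: smooth_on_const smooth_on_add)

lemma smooth_on_subset: "smooth_on f U \<Longrightarrow> V \<subseteq> U \<Longrightarrow> smooth_on f V"
  unfolding smooth_on_def using Ck_on_subset by blast

lemma smooth_on_cong: "open U \<Longrightarrow> (\<And>x. x \<in> U \<Longrightarrow> f x = g x) \<Longrightarrow> smooth_on f U \<longleftrightarrow> smooth_on g U"
  unfolding smooth_on_def using Ck_on_cong by blast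

lemma smooth_on_Un: "open U \<Longrightarrow> open V \<Longrightarrow> smooth_on f U \<Longrightarrow> smooth_on f V \<Longrightarrow> smooth_on f (U \<union> V)"
  unfolding smooth_on_def using Ck_on_Un by blast

lemma smooth_on_partial: "smooth_on f U \<Longrightarrow> smooth_on (partial i f) U"
  unfolding smooth_on_def by (metis Ck_on.simps(2))

lemma smooth_on_imp_differentiable: "smooth_on f U \<Longrightarrow> x \<in> U \<Longrightarrow> f differentiable (at x)"
  unfolding smooth_on_def by (metis Ck_on.simps(2))

lemma smooth_on_imp_continuous_on: "smooth_on f U \<Longrightarrow> continuous_on U f"
  unfolding smooth_on_def by (metis Ck_on.simps(1))

lemmas smooth_on_intros = smooth_on_const smooth_on_coord smooth_on_add smooth_on_mult
  smooth_on_uminus smooth_on_diff smooth_on_power smooth_on_divide smooth_on_sum smooth_on_partial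

section \<open>Test functions and integration by parts\<close>

lemma test_function_zero_outside: "test_function U \<eta> \<Longrightarrow> x \<notin> U \<Longrightarrow> \<eta> x = 0"
  unfolding test_function_def using closure_subset[of "{x. \<eta> x \<noteq> 0}"] by blast

lemma test_functionI:
  assumes "smooth_on \<eta> UNIV" "compact K" "K \<subseteq> U" "\<And>x. x \<notin> K \<Longrightarrow> \<eta> x = 0"
  shows "test_function U \<eta>"
proof -
  have "closure {x. \<eta> x \<noteq> 0} \<subseteq> K"
    by (rule closure_minimal) (use assms in \<open>auto simp: compact_imp_closed\<close>)
  then show ?thesis unfolding test_function_def
    using assms(1-3) bounded_subset[of K] by (auto simp: compact_eq_bounded_closed)
qed

lemma test_function_partial:
  assumes "test_function U \<eta>"
  shows "test_function U (partial i \<eta>)"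
proof (rule test_functionI[where K = "closure {x. \<eta> x \<noteq> 0}"])
  fix x assume x: "x \<notin> closure {x. \<eta> x \<noteq> 0}"
  have "partial i \<eta> x = partial i (\<lambda>x. 0) x"
    by (rule partial_cong_open[of "- closure {x. \<eta> x \<noteq> 0}"])
      (use x closure_subset[of "{x. \<eta> x \<noteq> 0}"] in auto)
  then show "partial i \<eta> x = 0" by simp
qed (use assms in \<open>auto simp: test_function_def intro: smooth_on_partial\<close>)

text \<open>Near a point outside the support of \<open>\<eta>\<close> the product vanishes, whatever \<open>f\<close> does there. So smoothness
is glued from \<open>U\<close> and the complement of the support.\<close>

lemma test_function_mult:
  assumes "open U" "smooth_on f U" "test_function U \<eta>"
  shows "test_function U (\<lambda>x. f x * \<eta> x)"
proof (rule test_functionI[where K = "closure {x. \<eta> x \<noteq> 0}"])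
  let ?K = "closure {x. \<eta> x \<noteq> 0}"
  have zero: "\<eta> x = 0" if "x \<notin> ?K" for x using that closure_subset[of "{x. \<eta> x \<noteq> 0}"] by auto
  have "smooth_on (\<lambda>x. f x * \<eta> x) (U \<union> (- ?K))"
  proof (rule smooth_on_Un)
    show "smooth_on (\<lambda>x. f x * \<eta> x) U"
      using assms smooth_on_subset[of \<eta> UNIV U]
      by (intro smooth_on_mult) (simp_all add: test_function_def)
    show "smooth_on (\<lambda>x. f x * \<eta> x) (- ?K)"
      by (rule smooth_on_cong[THEN iffD2, OF _ _ smooth_on_const[of 0]]) (auto dest: zero)
  qed (use assms in auto)
  moreover have "U \<union> (- ?K) = UNIV" using assms(3) unfolding test_function_def by blast
  ultimately show "smooth_on (\<lambda>x. f x * \<eta> x) UNIV" by simp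
  show "f x * \<eta> x = 0" if "x \<notin> ?K" for x using zero[OF that] by simp
qed (use assms in \<open>auto simp: test_function_def\<close>)

lemma test_function_add:
  assumes "test_function U f" "test_function U g"
  shows "test_function U (\<lambda>x. f x + g x)"
proof (rule test_functionI[where K = "closure {x. f x \<noteq> 0} \<union> closure {x. g x \<noteq> 0}"])
  show "f x + g x = 0" if "x \<notin> closure {x. f x \<noteq> 0} \<union> closure {x. g x \<noteq> 0}" for x
  proof -
    have "f x = 0" "g x = 0"
      using that closure_subset[of "{x. f x \<noteq> 0}"] closure_subset[of "{x. g x \<noteq> 0}"] by blast+
    then show ?thesis by simp
  qed
qed (use assms in \<open>auto simp: test_function_def intro: smooth_on_add\<close>)

lemma test_function_uminus: "test_function U f \<Longrightarrow> test_function U (\<lambda>x. - f x)"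
  by (auto simp: test_function_def intro: smooth_on_uminus)

lemma test_function_diff:
  "test_function U f \<Longrightarrow> test_function U g \<Longrightarrow> test_function U (\<lambda>x. f x - g x)"
  using test_function_add[OF _ test_function_uminus, of U f g] by simp

lemma test_function_integrable:
  assumes "test_function U \<eta>"
  shows "integrable lebesgue \<eta>"
proof -
  let ?K = "closure {x. \<eta> x \<noteq> 0}"
  have "continuous_on ?K \<eta>"
    using assms by (auto simp: test_function_def intro: continuous_on_subset smooth_on_imp_continuous_on)
  then have "integrable lborel (\<lambda>x. indicator ?K x *\<^sub>R \<eta> x)"
    using assms by (intro borel_integrable_compact) (auto simp: test_function_def)
  moreover have "(\<lambda>x. indicator ?K x *\<^sub>R \<eta> x) = \<eta>"
    using closure_subset[of "{x. \<eta> x \<noteq> 0}"] by (auto simp: fun_eq_iff indicator_def)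
  ultimately have "integrable lborel \<eta>" by simp
  then show ?thesis by (simp add: integrable_completion)
qed

lemma test_function_integrable_on:
  assumes "test_function U \<eta>" "open U"
  shows "integrable (lebesgue_on U) \<eta>"
proof -
  have "(\<lambda>x. indicator U x *\<^sub>R \<eta> x) = \<eta>"
    using test_function_zero_outside[OF assms(1)] by (auto simp: fun_eq_iff indicator_def)
  then show ?thesis
    using test_function_integrable[OF assms(1)] integrable_restrict_space[of U lebesgue \<eta>] assms(2)
    by simp
qed

lemma integral_lebesgue_on_supported:
  fixes f :: "real^'n \<Rightarrow> real"
  assumes "U \<in> sets lebesgue" "\<And>x. x \<notin> U \<Longrightarrow> f x = 0"
  shows "(LINT x|lebesgue_on U. f x) = (LINT x|lebesgue. f x)"
proof -
  have "(LINT x|lebesgue_on U. f x) = (LINT x|lebesgue. indicator U x *\<^sub>R f x)"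
    using assms(1) by (intro integral_restrict_space) auto
  also have "\<dots> = (LINT x|lebesgue. f x)"
    by (rule Bochner_Integration.integral_cong) (auto simp: assms(2) indicator_def)
  finally show ?thesis .
qed

lemma integral_test_function_translate:
  fixes g :: "real^'n::finite \<Rightarrow> real"
  assumes "test_function UNIV g"
  shows "integrable lborel (\<lambda>x. g (x + c))" "(LINT x|lborel. g (x + c)) = (LINT x|lborel. g x)"
proof -
  have cont: "continuous_on UNIV g"
    using assms by (simp add: test_function_def smooth_on_imp_continuous_on)
  then have m: "g \<in> borel_measurable borel" by (rule borel_measurable_continuous_onI)
  have "integrable lborel g"
    using test_function_integrable[OF assms] m by (simp add: integrable_completion)
  then have "integrable (distr lborel borel ((+) c)) g" by (simp add: lborel_distr_plus)
  then show "integrable lborel (\<lambda>x. g (x + c))"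
    using m by (simp add: integrable_distr_eq add.commute)
  have "(LINT x|lborel. g x) = (LINT x|distr lborel borel ((+) c). g x)"
    by (simp add: lborel_distr_plus)
  also have "\<dots> = (LINT x|lborel. g (c + x))" using m by (subst integral_distr) auto
  finally show "(LINT x|lborel. g (x + c)) = (LINT x|lborel. g x)" by (simp add: add.commute)
qed

lemma has_real_derivative_along_axis:
  fixes g :: "real^'n::finite \<Rightarrow> real"
  assumes "g differentiable (at (x + t *\<^sub>R axis i 1))"
  shows "((\<lambda>t. g (x + t *\<^sub>R axis i 1)) has_real_derivative partial i g (x + t *\<^sub>R axis i 1)) (at t)"
proof -
  have "((\<lambda>t. x + t *\<^sub>R axis i 1) has_derivative (\<lambda>s. s *\<^sub>R axis i 1)) (at t)"
    by (auto intro!: derivative_eq_intros)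
  from has_derivative_compose[OF this assms[unfolded frechet_derivative_works]]
  have d: "((\<lambda>t. g (x + t *\<^sub>R axis i 1)) has_derivative
      (\<lambda>s. frechet_derivative g (at (x + t *\<^sub>R axis i 1)) (s *\<^sub>R axis i 1))) (at t)" .
  have "linear (frechet_derivative g (at (x + t *\<^sub>R axis i 1)))"
    using assms linear_frechet_derivative by blast
  then show ?thesis
    using d unfolding has_field_derivative_def partial_def
    by (simp add: linear_scale mult.commute[of _ "frechet_derivative _ _ _"])
qed

text \<open>The integral of a difference quotient of \<open>g\<close> vanishes by translation invariance of Lebesgue measure. By the
mean value theorem the quotients are bounded by the supremum of \<open>\<bar>\<partial>\<^sub>i g\<bar>\<close>, and for increments of size at most 1
they live in one ball, so dominated convergence carries the vanishing over to \<open>\<partial>\<^sub>i g\<close>.\<close>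

lemma integral_partial_test_function:
  fixes g :: "real^'n::finite \<Rightarrow> real"
  assumes g: "test_function UNIV g"
  shows "(LINT x|lebesgue. partial i g x) = 0"
proof -
  let ?e = "axis i 1 :: real^'n" and ?K = "closure {x. g x \<noteq> 0}"
  let ?t = "\<lambda>n. 1 / real (Suc n)"
  let ?q = "\<lambda>n x. (g (x + ?t n *\<^sub>R ?e) - g x) / ?t n"
  have dg: "g differentiable (at x)" for x
    using g by (auto simp: test_function_def intro: smooth_on_imp_differentiable)
  have tp: "test_function UNIV (partial i g)" by (rule test_function_partial[OF g])
  have contg: "continuous_on UNIV g" and contp: "continuous_on UNIV (partial i g)"
    using g tp by (auto simp: test_function_def smooth_on_imp_continuous_on)
  have mp: "partial i g \<in> borel_measurable borel"
    by (rule borel_measurable_continuous_onI[OF contp])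
  have K: "compact ?K" using g by (simp add: test_function_def)
  have zero: "g x = 0" if "x \<notin> ?K" for x using that closure_subset[of "{x. g x \<noteq> 0}"] by auto
  have zerop: "partial i g x = 0" if "x \<notin> ?K" for x
  proof -
    have "partial i g x = partial i (\<lambda>_. 0) x"
    proof (rule partial_cong_open)
      show "open (- ?K)" by (rule open_Compl[OF closed_closure])
      show "x \<in> - ?K" using that by blast
      show "g y = 0" if "y \<in> - ?K" for y by (rule zero) (use that in blast)
    qed
    then show ?thesis by simp
  qed
  have "bounded (partial i g ` ?K)"
    using K contp by (intro compact_imp_bounded compact_continuous_image) (auto intro: continuous_on_subset)
  then obtain B0 where B0: "\<And>x. x \<in> ?K \<Longrightarrow> \<bar>partial i g x\<bar> \<le> B0"
    unfolding bounded_iff by (metis imageI real_norm_def)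
  define B where "B = max B0 0"
  have B: "\<bar>partial i g x\<bar> \<le> B" for x
    using B0[of x] zerop[of x] unfolding B_def by (cases "x \<in> ?K") auto
  obtain r where r: "\<And>x. x \<in> ?K \<Longrightarrow> norm x \<le> r"
    using compact_imp_bounded[OF K] unfolding bounded_iff by blast
  have quot: "\<bar>?q n x\<bar> \<le> B" for n x
  proof -
    have "norm (g (x + ?t n *\<^sub>R ?e) - g (x + 0 *\<^sub>R ?e)) \<le> B * norm (?t n - 0)"
    proof (rule field_differentiable_bound[where S = UNIV and f' = "\<lambda>t. partial i g (x + t *\<^sub>R ?e)"])
      show "((\<lambda>t. g (x + t *\<^sub>R ?e)) has_field_derivative partial i g (x + t *\<^sub>R ?e)) (at t within UNIV)"
        for t by (simp add: has_real_derivative_along_axis dg)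
    qed (use B in auto)
    then have "\<bar>g (x + ?t n *\<^sub>R ?e) - g x\<bar> \<le> B * ?t n" by simp
    moreover have "\<bar>?q n x\<bar> = \<bar>g (x + ?t n *\<^sub>R ?e) - g x\<bar> / ?t n"
      unfolding abs_divide by simp
    ultimately show ?thesis by (metis divide_pos_pos of_nat_0_less_iff pos_divide_le_eq zero_less_Suc zero_less_one)
  qed
  have supp: "?q n x = 0" if "norm x > r + 1" for n x
  proof -
    have "norm (?t n *\<^sub>R ?e) \<le> 1" by simp
    then have "norm (x + ?t n *\<^sub>R ?e) > r" using that norm_diff_ineq[of x "?t n *\<^sub>R ?e"] by linarith
    then have "x + ?t n *\<^sub>R ?e \<notin> ?K" "x \<notin> ?K" using r that by force+
    then have "g (x + ?t n *\<^sub>R ?e) = 0" "g x = 0" by (blast intro: zero)+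
    then show ?thesis by simp
  qed
  have "(\<lambda>n. LINT x|lborel. ?q n x) \<longlonglongrightarrow> (LINT x|lborel. partial i g x)"
  proof (rule integral_dominated_convergence[where w = "\<lambda>x. indicator (cball 0 (r + 1)) x *\<^sub>R B"])
    show "integrable lborel (\<lambda>x. indicator (cball 0 (r + 1) :: (real^'n) set) x *\<^sub>R B)"
      by (rule borel_integrable_compact) auto
    show "AE x in lborel. norm (?q n x) \<le> indicator (cball 0 (r + 1)) x *\<^sub>R B" for n
    proof (rule AE_I2)
      fix x show "norm (?q n x) \<le> indicator (cball 0 (r + 1)) x *\<^sub>R B"
        using quot[where x = x and n = n] supp[where x = x and n = n] by (cases "norm x \<le> r + 1") (auto simp: indicator_def)
    qed
    show "AE x in lborel. (\<lambda>n. ?q n x) \<longlonglongrightarrow> partial i g x"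
    proof (rule AE_I2)
      fix x
      have "((\<lambda>t. (g (x + t *\<^sub>R ?e) - g x) / t) \<longlongrightarrow> partial i g x) (at 0)"
        using has_real_derivative_along_axis[OF dg, where x = x and t = 0 and i = i] by (simp add: has_field_derivative_iff)
      moreover have "filterlim ?t (at 0) sequentially"
        unfolding filterlim_at using LIMSEQ_inverse_real_of_nat by (auto simp: inverse_eq_divide)
      ultimately show "(\<lambda>n. ?q n x) \<longlonglongrightarrow> partial i g x" by (rule filterlim_compose)
    qed
    show "?q n \<in> borel_measurable lborel" for n
    proof -
      have "continuous_on UNIV (?q n)"
        by (intro continuous_intros continuous_on_compose2[OF contg]) auto
      then show ?thesis by (simp add: borel_measurable_continuous_onI)
    qed
  qed (use mp in auto)
  moreover have "(LINT x|lborel. ?q n x) = 0" for n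
  proof -
    have "integrable lborel g" using integral_test_function_translate(1)[OF g, where c = 0] by simp
    then show ?thesis
      using integral_test_function_translate[OF g, where c = "?t n *\<^sub>R ?e"]
      by (simp add: Bochner_Integration.integral_diff)
  qed
  ultimately have "(\<lambda>n. 0) \<longlonglongrightarrow> (LINT x|lborel. partial i g x)" by simp
  then have "(LINT x|lborel. partial i g x) = 0" using LIMSEQ_unique tendsto_const by metis
  then show ?thesis using mp by (simp add: integral_completion)
qed

lemma integral_by_parts:
  fixes f \<eta> :: "real^'n::finite \<Rightarrow> real"
  assumes U: "open U" and f: "smooth_on f U" and \<eta>: "test_function U \<eta>"
  shows "(LINT x|lebesgue_on U. f x * partial i \<eta> x) = - (LINT x|lebesgue_on U. partial i f x * \<eta> x)"
proof -
  note tp = test_function_mult[OF U f test_function_partial[OF \<eta>], of i]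
  note tm = test_function_mult[OF U smooth_on_partial[OF f] \<eta>, of i]
  note t = test_function_mult[OF U f \<eta>]
  have tU: "test_function UNIV (\<lambda>x. f x * \<eta> x)" using t by (simp add: test_function_def)
  have "0 = (LINT x|lebesgue. partial i (\<lambda>x. f x * \<eta> x) x)"
    using integral_partial_test_function[OF tU] by simp
  also have "\<dots> = (LINT x|lebesgue_on U. partial i (\<lambda>x. f x * \<eta> x) x)"
    using U test_function_zero_outside[OF test_function_partial[OF t]]
    by (intro integral_lebesgue_on_supported[symmetric]) auto
  also have "\<dots> = (LINT x|lebesgue_on U. f x * partial i \<eta> x + partial i f x * \<eta> x)"
    using f \<eta> by (intro Bochner_Integration.integral_cong)
      (auto intro!: partial_mult smooth_on_imp_differentiable simp: test_function_def)
  also have "\<dots> = (LINT x|lebesgue_on U. f x * partial i \<eta> x) + (LINT x|lebesgue_on U. partial i f x * \<eta> x)"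
    by (intro Bochner_Integration.integral_add test_function_integrable_on[OF tp U]
        test_function_integrable_on[OF tm U])
  finally show ?thesis by simp
qed

lemma L1_loc_continuous:
  assumes "continuous_on U f"
  shows "L1_loc U f"
  unfolding L1_loc_def set_integrable_def
proof (intro allI impI)
  fix K assume "compact K \<and> K \<subseteq> U"
  then have "integrable lborel (\<lambda>x. indicator K x *\<^sub>R f x)"
    using assms by (intro borel_integrable_compact) (auto intro: continuous_on_subset)
  then show "integrable lebesgue (\<lambda>x. indicator K x *\<^sub>R f x)"
    by (metis borel_measurable_integrable integrable_completion)
qed

lemma weak_partial_smooth:
  assumes "open U" "smooth_on f U"
  shows "weak_partial U i f (partial i f)"
  unfolding weak_partial_def
  using assms by (auto intro!: L1_loc_continuous integral_by_parts smooth_on_imp_continuous_on smooth_on_partial)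

section \<open>A smooth cutoff\<close>

text \<open>The functions \<open>e\<^sub>j(t) = t\<^sup>-\<^sup>j exp (-1/t)\<close>, extended by zero to \<open>t \<le> 0\<close>, form a family whose span is closed under
differentiation: \<open>e\<^sub>j' = e\<^sub>j\<^sub>+\<^sub>2 - j e\<^sub>j\<^sub>+\<^sub>1\<close>. Smoothness of all of them then follows by one induction on the order of
differentiability. The function \<open>e\<^sub>0\<close> itself vanishes for \<open>t \<le> 0\<close> and tends to 1 at infinity, and serves as a cutoff.\<close>

definition exp_cutoff :: "nat \<Rightarrow> real \<Rightarrow> real" where
  "exp_cutoff j t = (if t > 0 then inverse t ^ j * exp (- inverse t) else 0)"

lemma power_mult_exp_minus_inverse_tendsto:
  "((\<lambda>t. inverse t ^ j * exp (- inverse t)) \<longlongrightarrow> (0::real)) (at_right 0)"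
proof -
  have "((\<lambda>y. y ^ j / exp y) \<longlongrightarrow> (0::real)) at_top" by (rule tendsto_power_div_exp_0)
  from filterlim_compose[OF this filterlim_inverse_at_top_right]
  show ?thesis by (simp add: exp_minus divide_inverse)
qed

lemma exp_cutoff_tendsto_0: "(exp_cutoff j \<longlongrightarrow> 0) (at 0)"
proof -
  have "(exp_cutoff j \<longlongrightarrow> 0) (at_right 0)"
    by (rule Lim_transform_eventually[OF power_mult_exp_minus_inverse_tendsto[of j]])
      (rule eventually_mono[OF eventually_at_right_less[of 0]], simp add: exp_cutoff_def)
  moreover have "(exp_cutoff j \<longlongrightarrow> 0) (at_left 0)"
    by (rule Lim_transform_eventually[OF tendsto_const])
      (rule eventually_at_leftI[of "-1"], auto simp: exp_cutoff_def)
  ultimately show ?thesis by (simp add: filterlim_at_split)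
qed

lemma exp_cutoff_deriv:
  "(exp_cutoff j has_real_derivative exp_cutoff (j + 2) t - real j * exp_cutoff (Suc j) t) (at t)"
proof -
  consider "t > 0" | "t = 0" | "t < 0" by linarith
  then show ?thesis
  proof cases
    case 1
    have "((\<lambda>t. inverse t ^ j * exp (- inverse t)) has_real_derivative
        exp_cutoff (j + 2) t - real j * exp_cutoff (Suc j) t) (at t)"
    proof -
      have "((\<lambda>t. inverse t ^ j * exp (- inverse t)) has_real_derivative
          inverse t ^ j * (exp (- inverse t) * (inverse t)\<^sup>2)
            - real j * (inverse t ^ (j - 1) * (inverse t)\<^sup>2) * exp (- inverse t)) (at t)"
        using 1 by (auto intro!: derivative_eq_intros simp: power2_eq_square algebra_simps)
      moreover have "real j * (inverse t ^ (j - 1) * (inverse t)\<^sup>2) = real j * inverse t ^ Suc j"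
        by (cases j) (simp_all add: power2_eq_square)
      ultimately have "((\<lambda>t. inverse t ^ j * exp (- inverse t)) has_real_derivative
          inverse t ^ j * (exp (- inverse t) * (inverse t)\<^sup>2)
            - real j * inverse t ^ Suc j * exp (- inverse t)) (at t)" by metis
      moreover have "inverse t ^ j * (exp (- inverse t) * (inverse t)\<^sup>2)
            - real j * inverse t ^ Suc j * exp (- inverse t)
          = exp_cutoff (j + 2) t - real j * exp_cutoff (Suc j) t"
        using 1 by (simp add: exp_cutoff_def power_add power2_eq_square)
      ultimately show ?thesis by metis
    qed
    then show ?thesis
      by (rule has_field_derivative_transform_within_open[where S = "{0<..}"])
        (use 1 in \<open>auto simp: exp_cutoff_def\<close>)
  next
    case 2
    have "exp_cutoff j y / y = exp_cutoff (Suc j) y" for y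
      by (simp add: exp_cutoff_def divide_inverse mult_ac)
    then have "((\<lambda>y. exp_cutoff j y / y) \<longlongrightarrow> 0) (at 0)" using exp_cutoff_tendsto_0 by simp
    then show ?thesis using 2 by (simp add: has_field_derivative_iff exp_cutoff_def)
  next
    case 3
    have "((\<lambda>t. 0) has_real_derivative 0) (at t)" by simp
    then have "(exp_cutoff j has_real_derivative 0) (at t)"
      by (rule has_field_derivative_transform_within_open[where S = "{..<0}"])
        (use 3 in \<open>auto simp: exp_cutoff_def\<close>)
    then show ?thesis using 3 by (simp add: exp_cutoff_def)
  qed
qed

lemma smooth_on_exp_cutoff:
  assumes "open U" "smooth_on f U"
  shows "smooth_on (\<lambda>x. exp_cutoff j (f x)) U"
proof -
  have "Ck_on k (\<lambda>x. exp_cutoff j (f x)) U" for k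
  proof (induction k arbitrary: j)
    case 0
    have "continuous_on UNIV (exp_cutoff j)"
      using exp_cutoff_deriv DERIV_isCont continuous_at_imp_continuous_on by blast
    then show ?case
      using smooth_on_imp_continuous_on[OF assms(2)] by (auto intro: continuous_on_compose2)
  next
    case (Suc k)
    have df: "f differentiable (at x)" if "x \<in> U" for x
      by (rule smooth_on_imp_differentiable[OF assms(2) that])
    have "Ck_on k (partial i (\<lambda>x. exp_cutoff j (f x))) U" for i
    proof (rule Ck_on_cong[OF assms(1), THEN iffD2])
      show "partial i (\<lambda>x. exp_cutoff j (f x)) x =
          (exp_cutoff (j + 2) (f x) + (- real j) * exp_cutoff (Suc j) (f x)) * partial i f x"
        if "x \<in> U" for x
        using partial_comp[OF df[OF that] exp_cutoff_deriv] by simp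
      show "Ck_on k (\<lambda>x. (exp_cutoff (j + 2) (f x) + (- real j) * exp_cutoff (Suc j) (f x)) * partial i f x) U"
        using assms by (intro Ck_on_mult Ck_on_add Ck_on_const Suc)
          (use smooth_on_partial[OF assms(2)] in \<open>auto simp: smooth_on_def\<close>)
    qed
    moreover have "(\<lambda>x. exp_cutoff j (f x)) differentiable (at x)" if "x \<in> U" for x
      using has_derivative_compose[OF df[OF that, unfolded frechet_derivative_works]
          exp_cutoff_deriv[unfolded has_field_derivative_def]] differentiable_def by blast
    ultimately show ?case by simp
  qed
  then show ?thesis by (simp add: smooth_on_def)
qed

lemma exp_cutoff_0_bounds: "0 \<le> exp_cutoff 0 t" "exp_cutoff 0 t \<le> 1"
  by (auto simp: exp_cutoff_def)

lemma exp_cutoff_0_tendsto_1: "(exp_cutoff 0 \<longlongrightarrow> 1) at_top"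
proof -
  have "((\<lambda>t::real. exp (- inverse t)) \<longlongrightarrow> exp (- 0)) at_top"
    by (intro tendsto_intros tendsto_inverse_0_at_top filterlim_ident)
  then show ?thesis
    by (intro Lim_transform_eventually[where g = "exp_cutoff 0"])
      (auto simp: exp_cutoff_def eventually_at_top_dense)
qed

text \<open>In terms of \<open>y = 1 / t\<close> the product is \<open>(y + y\<^sup>2) e\<^sup>-\<^sup>y\<close>. With \<open>t + 1 = n s\<close> it is the factor
by which \<open>s\<close> times the gradient of the cutoff \<open>e\<^sub>0(n s - 1)\<close> differs from the gradient of \<open>s\<close>.\<close>

lemma exp_cutoff_2_weighted_bounds:
  "0 \<le> (t + 1) * exp_cutoff 2 t" "(t + 1) * exp_cutoff 2 t \<le> 2"
  and exp_cutoff_2_weighted_tendsto_0: "((\<lambda>t. (t + 1) * exp_cutoff 2 t) \<longlongrightarrow> 0) at_top"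
proof -
  have eq: "(t + 1) * exp_cutoff 2 t = (inverse t + inverse t ^ 2) * exp (- inverse t)" if "t > 0" for t
    using that by (simp add: exp_cutoff_def field_simps power2_eq_square)
  show "0 \<le> (t + 1) * exp_cutoff 2 t" by (auto simp: exp_cutoff_def)
  show "(t + 1) * exp_cutoff 2 t \<le> 2"
  proof (cases "t > 0")
    case True
    define y where "y = inverse t"
    have y: "y > 0" using True by (simp add: y_def)
    have "1 + y + y\<^sup>2 / 2 \<le> exp y" using exp_lower_Taylor_quadratic[of y] y by simp
    then have "y + y\<^sup>2 \<le> 2 * exp y" using y by simp
    then have "(y + y\<^sup>2) * exp (- y) \<le> 2 * exp y * exp (- y)" by (intro mult_right_mono) auto
    also have "\<dots> = 2" by (simp add: exp_minus)
    finally show ?thesis using eq[OF True] by (simp add: y_def)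
  qed (simp add: exp_cutoff_def)
  have "((\<lambda>t::real. (inverse t + inverse t ^ 2) * exp (- inverse t)) \<longlongrightarrow> (0 + 0\<^sup>2) * exp (- 0)) at_top"
    by (intro tendsto_intros tendsto_inverse_0_at_top filterlim_ident)
  then show "((\<lambda>t. (t + 1) * exp_cutoff 2 t) \<longlongrightarrow> 0) at_top"
    by (intro Lim_transform_eventually[where g = "\<lambda>t. (t + 1) * exp_cutoff 2 t"])
      (auto simp: eventually_at_top_dense intro!: exI[of _ 0] eq[symmetric])
qed

section \<open>Complex coordinates and Wirtinger derivatives\<close>

definition cplx :: "real^2 \<Rightarrow> complex" where
  "cplx x = Complex (x $ 1) (x $ 2)"

lemma Re_cplx [simp]: "Re (cplx x) = x $ 1" and Im_cplx [simp]: "Im (cplx x) = x $ 2"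
  by (simp_all add: cplx_def)

lemma norm_cplx [simp]: "norm (cplx x) = norm x"
  by (simp add: cmod_def norm_vec_def L2_set_def UNIV_2)

lemma bounded_linear_cplx: "bounded_linear cplx"
  by (rule bounded_linear_intro[where K = 1]) (auto simp: complex_eq_iff simp flip: norm_cplx)

lemma continuous_on_cplx [continuous_intros]: "continuous_on S cplx"
  using bounded_linear_cplx linear_continuous_on by blast

lemma cplx_vector [simp]: "cplx (vector [Re z, Im z]) = z"
  by (simp add: complex_eq_iff)

lemma cplx_axis: "cplx (axis 1 1) = 1" "cplx (axis 2 1) = \<i>"
  by (auto simp: complex_eq_iff axis_def)

text \<open>\<open>A\<close> is the derivative with respect to \<open>z\<close>, and \<open>B\<close> the one with respect to its conjugate.\<close>

definition has_wirtinger :: "(complex \<Rightarrow> complex) \<Rightarrow> complex \<Rightarrow> complex \<Rightarrow> complex \<Rightarrow> bool" where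
  "has_wirtinger F A B z \<longleftrightarrow> (F has_derivative (\<lambda>v. A * v + B * cnj v)) (at z)"

lemma has_wirtinger_eq:
  "has_wirtinger F A B z \<Longrightarrow> A = A' \<Longrightarrow> B = B' \<Longrightarrow> has_wirtinger F A' B' z"
  by simp

lemma has_wirtinger_holomorphic:
  "(F has_field_derivative d) (at z) \<Longrightarrow> has_wirtinger F d 0 z"
  by (simp add: has_wirtinger_def has_field_derivative_def)

lemma has_wirtinger_cnj:
  assumes "has_wirtinger F A B z"
  shows "has_wirtinger (\<lambda>z. cnj (F z)) (cnj B) (cnj A) z"
  using has_derivative_cnj[OF assms[unfolded has_wirtinger_def]]
  by (simp add: has_wirtinger_def add.commute)

lemma has_wirtinger_add:
  assumes "has_wirtinger F A B z" "has_wirtinger G C D z"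
  shows "has_wirtinger (\<lambda>z. F z + G z) (A + C) (B + D) z"
  using has_derivative_add[OF assms[unfolded has_wirtinger_def]]
  by (simp add: has_wirtinger_def algebra_simps)

lemma has_wirtinger_mult:
  assumes "has_wirtinger F A B z" "has_wirtinger G C D z"
  shows "has_wirtinger (\<lambda>z. F z * G z) (A * G z + F z * C) (B * G z + F z * D) z"
  using has_derivative_mult[OF assms[unfolded has_wirtinger_def]]
  by (simp add: has_wirtinger_def algebra_simps)

lemma has_wirtinger_compose:
  assumes "has_wirtinger F A B (w z)" "(w has_field_derivative d) (at z)"
  shows "has_wirtinger (\<lambda>z. F (w z)) (A * d) (B * cnj d) z"
  using has_derivative_compose[OF assms(2)[unfolded has_field_derivative_def] assms(1)[unfolded has_wirtinger_def]]
  by (simp add: has_wirtinger_def mult.assoc)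

lemma partial_wirtinger:
  assumes "has_wirtinger F A B (cplx x)"
  shows "partial 1 (\<lambda>x. Re (F (cplx x))) x = Re (A + B)"
    and "partial 2 (\<lambda>x. Re (F (cplx x))) x = Im (B - A)"
    and "partial 1 (\<lambda>x. Im (F (cplx x))) x = Im (A + B)"
    and "partial 2 (\<lambda>x. Im (F (cplx x))) x = Re (A - B)"
proof -
  have d: "((\<lambda>x. F (cplx x)) has_derivative (\<lambda>v. A * cplx v + B * cnj (cplx v))) (at x)"
    using has_derivative_compose[OF bounded_linear.has_derivative[OF bounded_linear_cplx has_derivative_ident]
        assms[unfolded has_wirtinger_def]] .
  note dRe = partial_eq[OF bounded_linear.has_derivative[OF bounded_linear_Re d]]
    and dIm = partial_eq[OF bounded_linear.has_derivative[OF bounded_linear_Im d]]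
  show "partial 1 (\<lambda>x. Re (F (cplx x))) x = Re (A + B)"
    and "partial 2 (\<lambda>x. Re (F (cplx x))) x = Im (B - A)"
    by (simp_all add: dRe cplx_axis)
  show "partial 1 (\<lambda>x. Im (F (cplx x))) x = Im (A + B)"
    and "partial 2 (\<lambda>x. Im (F (cplx x))) x = Re (A - B)"
    by (simp_all add: dIm cplx_axis)
qed

definition csmooth_on :: "(complex \<Rightarrow> complex) \<Rightarrow> (real^2) set \<Rightarrow> bool" where
  "csmooth_on F U \<longleftrightarrow>
     smooth_on (\<lambda>x. Re (F (cplx x))) U \<and> smooth_on (\<lambda>x. Im (F (cplx x))) U"

lemma csmooth_on_const: "csmooth_on (\<lambda>z. c) U"
  and csmooth_on_id: "csmooth_on (\<lambda>z. z) U"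
  by (simp_all add: csmooth_on_def smooth_on_const smooth_on_coord)

lemma csmooth_on_cnj: "open U \<Longrightarrow> csmooth_on F U \<Longrightarrow> csmooth_on (\<lambda>z. cnj (F z)) U"
  and csmooth_on_add:
    "open U \<Longrightarrow> csmooth_on F U \<Longrightarrow> csmooth_on G U \<Longrightarrow> csmooth_on (\<lambda>z. F z + G z) U"
  and csmooth_on_diff:
    "open U \<Longrightarrow> csmooth_on F U \<Longrightarrow> csmooth_on G U \<Longrightarrow> csmooth_on (\<lambda>z. F z - G z) U"
  and csmooth_on_mult:
    "open U \<Longrightarrow> csmooth_on F U \<Longrightarrow> csmooth_on G U \<Longrightarrow> csmooth_on (\<lambda>z. F z * G z) U"
  by (simp_all add: csmooth_on_def smooth_on_intros)

lemma csmooth_on_inverse: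
  assumes "open U" "csmooth_on F U" "\<And>x. x \<in> U \<Longrightarrow> F (cplx x) \<noteq> 0"
  shows "csmooth_on (\<lambda>z. inverse (F z)) U"
proof -
  have "(Re (F (cplx x)))\<^sup>2 + (Im (F (cplx x)))\<^sup>2 \<noteq> 0" if "x \<in> U" for x
    using assms(3)[OF that] by (simp add: complex_eq_iff sum_power2_eq_zero_iff)
  then show ?thesis
    using assms(1,2) by (simp add: csmooth_on_def smooth_on_intros)
qed

lemma csmooth_on_divide:
  "open U \<Longrightarrow> csmooth_on F U \<Longrightarrow> csmooth_on G U \<Longrightarrow> (\<And>x. x \<in> U \<Longrightarrow> G (cplx x) \<noteq> 0) \<Longrightarrow>
    csmooth_on (\<lambda>z. F z / G z) U"
  unfolding divide_inverse by (intro csmooth_on_mult csmooth_on_inverse) auto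

lemma csmooth_on_power: "open U \<Longrightarrow> csmooth_on F U \<Longrightarrow> csmooth_on (\<lambda>z. F z ^ n) U"
  by (induction n) (simp_all add: csmooth_on_const csmooth_on_mult)

lemmas csmooth_on_intros = csmooth_on_const csmooth_on_id csmooth_on_cnj csmooth_on_add
  csmooth_on_diff csmooth_on_mult csmooth_on_divide csmooth_on_power

section \<open>Moebius maps of the disc\<close>

locale disc_point =
  fixes b :: complex
  assumes b: "norm b < 1"
begin

text \<open>\<open>mob\<close> is the automorphism of the disc that moves \<open>b\<close> to the origin, and \<open>dmob\<close> is its complex derivative.\<close>

definition mob_num :: "complex \<Rightarrow> complex" where "mob_num z = z - b"
definition mob_den :: "complex \<Rightarrow> complex" where "mob_den z = 1 - cnj b * z"
definition mob :: "complex \<Rightarrow> complex" where "mob z = mob_num z / mob_den z"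
definition dmob :: "complex \<Rightarrow> complex" where "dmob z = (1 - b * cnj b) / (mob_den z)\<^sup>2"

text \<open>The set on which \<open>mob\<close> and \<open>1 / mob\<close> are both defined. It contains a neighbourhood of the circle at infinity, so
that smoothness on it yields bounds up to that circle.\<close>

definition punctured :: "(real^2) set" where
  "punctured = {x. mob_num (cplx x) \<noteq> 0 \<and> mob_den (cplx x) \<noteq> 0}"

lemma open_punctured: "open punctured"
  unfolding punctured_def mob_num_def mob_den_def
  by (intro open_Collect_conj open_Collect_neq continuous_intros)

lemma mob_den_nonzero: "norm z \<le> 1 \<Longrightarrow> mob_den z \<noteq> 0"
proof
  assume "norm z \<le> 1" "mob_den z = 0"
  then have "norm b * norm z = 1" by (metis mob_den_def complex_mod_cnj eq_iff_diff_eq_0 norm_mult norm_one)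
  moreover have "norm b * norm z \<le> norm b * 1" using \<open>norm z \<le> 1\<close> by (intro mult_left_mono) auto
  ultimately show False using b by simp
qed

lemma norm_mob_den_num: "(norm (mob_den z))\<^sup>2 - (norm (mob_num z))\<^sup>2 = (1 - (norm b)\<^sup>2) * (1 - (norm z)\<^sup>2)"
  unfolding mob_den_def mob_num_def cmod_power2 by (simp add: power2_eq_square algebra_simps)

lemma norm_dmob: "norm (dmob z) = (1 - (norm b)\<^sup>2) / (norm (mob_den z))\<^sup>2"
proof -
  have "1 - b * cnj b = of_real (1 - (norm b)\<^sup>2)" by (simp only: of_real_diff of_real_1 complex_norm_square)
  moreover have "(norm b)\<^sup>2 < 1" using b by (simp add: abs_square_less_1)
  ultimately show ?thesis
    unfolding dmob_def by (simp only: norm_divide norm_power norm_of_real)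
qed

text \<open>The pulled back metric of the disc is the metric of the disc: \<open>mob\<close> is a hyperbolic isometry.\<close>

lemma mob_conformal:
  assumes "mob_den z \<noteq> 0"
  shows "norm (dmob z) * (1 - (norm z)\<^sup>2) = 1 - (norm (mob z))\<^sup>2"
  using assms norm_mob_den_num[of z] unfolding norm_dmob mob_def norm_divide by (simp add: field_simps)

lemma mob_has_field_derivative: "mob_den z \<noteq> 0 \<Longrightarrow> (mob has_field_derivative dmob z) (at z)"
  unfolding mob_def[abs_def] dmob_def mob_num_def mob_den_def
  by (auto intro!: derivative_eq_intros simp: power2_eq_square field_simps)

lemma dmob_differentiable: "mob_den z \<noteq> 0 \<Longrightarrow> dmob field_differentiable (at z)"
  unfolding dmob_def[abs_def] mob_den_def by (intro derivative_intros) auto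

end

section \<open>The explicit flow\<close>

text \<open>The hyperbolic metric is the identity matrix divided by this factor. So the inverse metric is the identity times
it, and in dimension two its reciprocal is also the volume density.\<close>

definition inv_factor :: "real \<Rightarrow> real^2 \<Rightarrow> real" where
  "inv_factor a x = a\<^sup>2 * (1 - (norm x)\<^sup>2)\<^sup>2 / 4"

locale exterior_flow = disc_point b for b :: complex +
  fixes a k :: real
  assumes a: "a > 0" and k: "0 < k" "k < 1"
begin

text \<open>In the coordinate \<open>w = mob z\<close> the stream function is the real part of \<open>(\<bar>w\<bar>\<^sup>2 - k\<^sup>2)\<^sup>2 / w\<^sup>2\<close>, and \<open>flow_profile\<close> is twice
its derivative with respect to \<open>w\<close>. The factor \<open>\<bar>w\<bar>\<^sup>2 - k\<^sup>2\<close> that is left over makes the velocity vanish on the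
boundary circle.

The stream function is the sum of the real parts of \<open>potential\<close>, which is holomorphic, and of \<open>vorticity_profile\<close>.
The latter real part is \<open>k\<^sup>2 (1 - \<bar>w\<bar>\<^sup>2)\<^sup>2 Re (w\<^sup>-\<^sup>2)\<close>, an eigenfunction of the Laplacian for the eigenvalue \<open>2 a\<^sup>2\<close>.\<close>

definition flow_profile :: "complex \<Rightarrow> complex" where
  "flow_profile w = 2 * (w * cnj w - of_real k ^ 2) * (inverse (cnj w) + of_real k ^ 2 * inverse w ^ 3)"

definition potential :: "complex \<Rightarrow> complex" where
  "potential w = (1 - of_real k ^ 2) * (w\<^sup>2 - of_real k ^ 2 * inverse w ^ 2)"

definition potential_deriv :: "complex \<Rightarrow> complex" where
  "potential_deriv w = (1 - of_real k ^ 2) * (2 * w + 2 * of_real k ^ 2 * inverse w ^ 3)"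

definition vorticity_profile :: "complex \<Rightarrow> complex" where
  "vorticity_profile w = of_real k ^ 2 * (inverse w - cnj w)\<^sup>2"

lemma inverse_power_deriv:
  "w \<noteq> 0 \<Longrightarrow> ((\<lambda>w::complex. inverse w ^ n) has_field_derivative - (of_nat n * inverse w ^ Suc n)) (at w)"
proof (cases n)
  case (Suc m)
  assume "w \<noteq> 0"
  then have "((\<lambda>w. inverse w ^ n) has_field_derivative of_nat n * (- (inverse w ^ 2) * inverse w ^ (n - 1))) (at w)"
    by (auto intro!: derivative_eq_intros simp: power2_eq_square)
  then show ?thesis using Suc by (simp add: power2_eq_square mult.assoc)
qed simp

lemma flow_profile_wirtinger:
  assumes "w \<noteq> 0"
  shows "\<exists>A. has_wirtinger flow_profile A (2 * of_real k ^ 2 * (inverse w ^ 2 + cnj (inverse w ^ 2))) w"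
proof -
  note wc = has_wirtinger_holomorphic[OF DERIV_const]
    and wi = has_wirtinger_holomorphic[OF DERIV_ident]
    and wv = has_wirtinger_holomorphic[OF inverse_power_deriv[OF assms]]
  have prof: "flow_profile = (\<lambda>w. 2 * (w * cnj w + (- (of_real k ^ 2))) * (cnj (inverse w ^ 1) + of_real k ^ 2 * inverse w ^ 3))"
    by (auto simp: flow_profile_def)
  show ?thesis unfolding prof
    apply (rule exI, rule has_wirtinger_eq)
      apply (rule has_wirtinger_mult has_wirtinger_add has_wirtinger_cnj wc wi wv)+
     apply (rule refl)
    using assms by (simp add: field_simps eval_nat_numeral)
qed

lemma potential_has_field_derivative: "w \<noteq> 0 \<Longrightarrow> (potential has_field_derivative potential_deriv w) (at w)"
  unfolding potential_def[abs_def] potential_deriv_def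
  by (auto intro!: derivative_eq_intros inverse_power_deriv simp: eval_nat_numeral algebra_simps)

text \<open>Twice the \<open>w\<close>-derivative of \<open>Re \<circ> vorticity_profile\<close> is \<open>A + cnj B\<close>. So the lemma is the splitting of the stream
function, at the level of gradients; up to the factor \<open>2 a\<^sup>2\<close> it is the momentum equation.\<close>

lemma vorticity_profile_wirtinger:
  assumes "w \<noteq> 0"
  shows "\<exists>A B. has_wirtinger vorticity_profile A B w \<and> A + cnj B = flow_profile w - potential_deriv w"
proof -
  note wc = has_wirtinger_holomorphic[OF DERIV_const]
    and wi = has_wirtinger_holomorphic[OF DERIV_ident]
    and wv = has_wirtinger_holomorphic[OF inverse_power_deriv[OF assms]]
  have prof: "vorticity_profile = (\<lambda>w. of_real k ^ 2 * ((inverse w ^ 1 + (-1) * cnj w) * (inverse w ^ 1 + (-1) * cnj w)))"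
    by (auto simp: vorticity_profile_def power2_eq_square)
  show ?thesis unfolding prof
    apply (intro exI conjI)
     apply (rule has_wirtinger_mult has_wirtinger_add has_wirtinger_cnj wc wi wv)+
    using assms by (simp add: flow_profile_def potential_deriv_def field_simps eval_nat_numeral)
qed

text \<open>Twice the \<open>z\<close>-derivative of the stream function, so that \<open>flow\<close> is its gradient turned by a right angle.\<close>

definition complex_flow :: "complex \<Rightarrow> complex" where "complex_flow z = flow_profile (mob z) * dmob z"

definition flow :: "real^2 \<Rightarrow> real^2" where
  "flow x = vector [Im (complex_flow (cplx x)), Re (complex_flow (cplx x))]"

definition pressure :: "real^2 \<Rightarrow> real" where
  "pressure x = - 2 * a\<^sup>2 * Im (potential (mob (cplx x)))"

definition vorticity :: "real^2 \<Rightarrow> real" where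
  "vorticity x = 2 * a\<^sup>2 * Re (vorticity_profile (mob (cplx x)))"

lemma flow_nth [simp]: "flow x $ 1 = Im (complex_flow (cplx x))" "flow x $ 2 = Re (complex_flow (cplx x))"
  by (simp_all add: flow_def)

lemma mob_nonzero: "x \<in> punctured \<Longrightarrow> mob (cplx x) \<noteq> 0"
  by (simp add: punctured_def mob_def)

lemma csmooth_mob: "csmooth_on mob punctured" and csmooth_dmob: "csmooth_on dmob punctured"
  unfolding mob_def[abs_def] dmob_def[abs_def] mob_num_def mob_den_def
  by (intro csmooth_on_intros open_punctured; simp add: punctured_def mob_num_def mob_den_def)+

lemma csmooth_inverse_mob: "csmooth_on (\<lambda>z. inverse (mob z)) punctured"
  by (intro csmooth_on_inverse open_punctured csmooth_mob mob_nonzero)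

lemma csmooth_complex_flow: "csmooth_on complex_flow punctured"
proof -
  have "complex_flow = (\<lambda>z. 2 * (mob z * cnj (mob z) - of_real k ^ 2)
      * (cnj (inverse (mob z)) + of_real k ^ 2 * inverse (mob z) ^ 3) * dmob z)"
    by (simp add: complex_flow_def flow_profile_def fun_eq_iff)
  then show ?thesis
    by (simp only:) (intro csmooth_on_intros open_punctured csmooth_mob csmooth_inverse_mob csmooth_dmob)
qed

lemma smooth_flow: "smooth_on (\<lambda>x. flow x $ i) punctured"
  using csmooth_complex_flow exhaust_2[of i] by (auto simp: csmooth_on_def)

lemma csmooth_potential: "csmooth_on (\<lambda>z. potential (mob z)) punctured"
  and csmooth_vorticity_profile: "csmooth_on (\<lambda>z. vorticity_profile (mob z)) punctured"
  unfolding potential_def vorticity_profile_def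
  by (intro csmooth_on_intros open_punctured csmooth_mob csmooth_inverse_mob)+

lemma smooth_pressure: "smooth_on pressure punctured"
  using csmooth_potential unfolding pressure_def[abs_def] csmooth_on_def
  by (intro smooth_on_intros open_punctured) auto

lemma smooth_vorticity: "smooth_on vorticity punctured"
  using csmooth_vorticity_profile unfolding vorticity_def[abs_def] csmooth_on_def
  by (intro smooth_on_intros open_punctured) auto

text \<open>For \<open>u = (Im E, Re E)\<close> twice the anti-holomorphic derivative of \<open>E\<close> is \<open>curl u + i div u\<close>. That it is real says
that \<open>u\<close> is divergence free, and its value is half the curl.\<close>

lemma complex_flow_wirtinger:
  assumes "x \<in> punctured"
  defines "w \<equiv> mob (cplx x)"
  shows "\<exists>A. has_wirtinger complex_flow A
    (of_real (4 * k\<^sup>2 * Re (inverse w ^ 2) * (norm (dmob (cplx x)))\<^sup>2)) (cplx x)"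
proof -
  let ?z = "cplx x"
  have M: "mob_den ?z \<noteq> 0" and w: "w \<noteq> 0" using assms mob_nonzero by (auto simp: punctured_def)
  obtain A where A: "has_wirtinger flow_profile A (2 * of_real k ^ 2 * (inverse w ^ 2 + cnj (inverse w ^ 2))) w"
    using flow_profile_wirtinger[OF w] by blast
  obtain d where d: "(dmob has_field_derivative d) (at ?z)"
    using dmob_differentiable[OF M] unfolding field_differentiable_def by blast
  have "has_wirtinger complex_flow (A * dmob ?z * dmob ?z + flow_profile w * d)
      (2 * of_real k ^ 2 * (inverse w ^ 2 + cnj (inverse w ^ 2)) * cnj (dmob ?z) * dmob ?z + flow_profile w * 0) ?z"
    unfolding complex_flow_def[abs_def] w_def
    by (rule has_wirtinger_mult[OF has_wirtinger_compose[OF A[unfolded w_def] mob_has_field_derivative[OF M]]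
          has_wirtinger_holomorphic[OF d]])
  moreover have "2 * of_real k ^ 2 * (inverse w ^ 2 + cnj (inverse w ^ 2)) * cnj (dmob ?z) * dmob ?z + flow_profile w * 0
      = of_real (4 * k\<^sup>2 * Re (inverse w ^ 2) * (norm (dmob ?z))\<^sup>2)"
    unfolding complex_add_cnj of_real_mult complex_norm_square by (simp add: mult_ac)
  ultimately show ?thesis by metis
qed

lemma flow_divergence_free:
  assumes "x \<in> punctured"
  shows "partial 1 (\<lambda>y. flow y $ 1) x + partial 2 (\<lambda>y. flow y $ 2) x = 0"
proof -
  obtain A where "has_wirtinger complex_flow A
      (of_real (4 * k\<^sup>2 * Re (inverse (mob (cplx x)) ^ 2) * (norm (dmob (cplx x)))\<^sup>2)) (cplx x)"
    using complex_flow_wirtinger[OF assms] by blast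
  then show ?thesis by (simp add: partial_wirtinger)
qed

lemma flow_curl:
  assumes "x \<in> punctured"
  shows "inv_factor a x * (partial 1 (\<lambda>y. flow y $ 2) x - partial 2 (\<lambda>y. flow y $ 1) x) = vorticity x"
proof -
  let ?z = "cplx x" and ?w = "mob (cplx x)"
  have M: "mob_den ?z \<noteq> 0" and w: "?w \<noteq> 0" using assms mob_nonzero by (auto simp: punctured_def)
  have "partial 1 (\<lambda>y. flow y $ 2) x - partial 2 (\<lambda>y. flow y $ 1) x
      = 8 * k\<^sup>2 * Re (inverse ?w ^ 2) * (norm (dmob ?z))\<^sup>2"
  proof -
    obtain A where "has_wirtinger complex_flow A
        (of_real (4 * k\<^sup>2 * Re (inverse ?w ^ 2) * (norm (dmob ?z))\<^sup>2)) ?z"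
      using complex_flow_wirtinger[OF assms] by blast
    then show ?thesis by (simp add: partial_wirtinger)
  qed
  then have "inv_factor a x * (partial 1 (\<lambda>y. flow y $ 2) x - partial 2 (\<lambda>y. flow y $ 1) x)
      = 2 * a\<^sup>2 * k\<^sup>2 * (norm (dmob ?z) * (1 - (norm ?z)\<^sup>2))\<^sup>2 * Re (inverse ?w ^ 2)"
    by (simp add: inv_factor_def power_mult_distrib)
  also have "\<dots> = 2 * a\<^sup>2 * k\<^sup>2 * (1 - (norm ?w)\<^sup>2)\<^sup>2 * Re (inverse ?w ^ 2)"
    unfolding mob_conformal[OF M] ..
  also have "(inverse ?w - cnj ?w)\<^sup>2 = of_real ((1 - (norm ?w)\<^sup>2)\<^sup>2) * inverse ?w ^ 2"
    using w by (simp add: complex_norm_square[symmetric] field_simps power2_eq_square)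
  then have "2 * a\<^sup>2 * k\<^sup>2 * (1 - (norm ?w)\<^sup>2)\<^sup>2 * Re (inverse ?w ^ 2) = vorticity x"
    unfolding vorticity_def vorticity_profile_def by (simp flip: of_real_power)
  finally show ?thesis .
qed

text \<open>The two components are the imaginary and the real part of one complex identity, because the pressure is a multiple
of the imaginary part of a holomorphic function, whose gradient is given by the Cauchy-Riemann equations.\<close>

lemma flow_momentum:
  assumes "x \<in> punctured"
  shows "partial 2 vorticity x + 2 * a\<^sup>2 * flow x $ 1 + partial 1 pressure x = 0"
    and "- partial 1 vorticity x + 2 * a\<^sup>2 * flow x $ 2 + partial 2 pressure x = 0"
proof -
  let ?z = "cplx x" and ?w = "mob (cplx x)"
  have M: "mob_den ?z \<noteq> 0" and w: "?w \<noteq> 0" using assms mob_nonzero by (auto simp: punctured_def)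
  obtain A B where AB: "has_wirtinger vorticity_profile A B ?w" "A + cnj B = flow_profile ?w - potential_deriv ?w"
    using vorticity_profile_wirtinger[OF w] by blast
  note Yw = partial_wirtinger[OF has_wirtinger_compose[OF AB(1) mob_has_field_derivative[OF M]]]
  have "((\<lambda>z. potential (mob z)) has_field_derivative potential_deriv ?w * dmob ?z) (at ?z)"
    by (rule DERIV_chain2[OF potential_has_field_derivative[OF w] mob_has_field_derivative[OF M]])
  note Hw = partial_wirtinger[OF has_wirtinger_holomorphic[OF this]]
  have dY: "(\<lambda>x. Re (vorticity_profile (mob (cplx x)))) differentiable (at x)"
    and dH: "(\<lambda>x. Im (potential (mob (cplx x)))) differentiable (at x)"
    using csmooth_vorticity_profile csmooth_potential assms by (auto simp: csmooth_on_def intro: smooth_on_imp_differentiable)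
  have key: "A * dmob ?z + cnj (B * cnj (dmob ?z)) = complex_flow ?z - potential_deriv ?w * dmob ?z"
    using arg_cong[OF AB(2), of "\<lambda>t. t * dmob ?z"] by (simp add: complex_flow_def algebra_simps)
  have re: "Re (A * dmob ?z + B * cnj (dmob ?z)) = Re (complex_flow ?z) - Re (potential_deriv ?w * dmob ?z)"
    using arg_cong[OF key, of Re] by simp
  have im: "Im (B * cnj (dmob ?z) - A * dmob ?z) = - Im (complex_flow ?z) + Im (potential_deriv ?w * dmob ?z)"
    using arg_cong[OF key, of Im] by simp
  show "partial 2 vorticity x + 2 * a\<^sup>2 * flow x $ 1 + partial 1 pressure x = 0"
    unfolding vorticity_def[abs_def] pressure_def[abs_def] partial_cmult[OF dY] partial_cmult[OF dH] Yw Hw im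
    by (simp add: algebra_simps)
  show "- partial 1 vorticity x + 2 * a\<^sup>2 * flow x $ 2 + partial 2 pressure x = 0"
    unfolding vorticity_def[abs_def] pressure_def[abs_def] partial_cmult[OF dY] partial_cmult[OF dH] Yw Hw re
    by (simp add: algebra_simps)
qed

text \<open>The exterior of the disc of geodesic radius \<open>(2/a) artanh k\<close> around \<open>b\<close>. Its closure in the closed Euclidean
disc, \<open>exterior_closure\<close>, is compact, and all bounds on the flow come from continuity there. The polynomial
\<open>boundary_fun\<close> is positive on the exterior only, and has simple zeros on both boundary circles.\<close>

definition exterior :: "(real^2) set" where
  "exterior = {x. norm x < 1 \<and> k < norm (mob (cplx x))}"

definition boundary_fun :: "real^2 \<Rightarrow> real" where
  "boundary_fun x = ((norm (mob_num (cplx x)))\<^sup>2 - k\<^sup>2 * (norm (mob_den (cplx x)))\<^sup>2) * (1 - (norm x)\<^sup>2)"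

definition exterior_closure :: "(real^2) set" where
  "exterior_closure = {x. norm x \<le> 1 \<and> k * norm (mob_den (cplx x)) \<le> norm (mob_num (cplx x))}"

lemma exterior_closure_punctured: "exterior_closure \<subseteq> punctured"
proof
  fix x assume x: "x \<in> exterior_closure"
  then have "mob_den (cplx x) \<noteq> 0" by (intro mob_den_nonzero) (simp add: exterior_closure_def)
  then have "k * norm (mob_den (cplx x)) > 0" using k by simp
  then show "x \<in> punctured" using x \<open>mob_den (cplx x) \<noteq> 0\<close> by (auto simp: punctured_def exterior_closure_def)
qed

lemma compact_exterior_closure: "compact exterior_closure"
proof -
  have "exterior_closure = cball 0 1 \<inter> {x. k * norm (mob_den (cplx x)) \<le> norm (mob_num (cplx x))}"
    by (auto simp: exterior_closure_def)
  moreover have "closed {x. k * norm (mob_den (cplx x)) \<le> norm (mob_num (cplx x))}"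
    unfolding mob_den_def mob_num_def by (intro closed_Collect_le continuous_intros)
  ultimately show ?thesis by (simp add: compact_Int_closed)
qed

lemma exterior_iff_boundary_fun: "x \<in> exterior \<longleftrightarrow> boundary_fun x > 0"
proof -
  let ?z = "cplx x"
  have kM: "k\<^sup>2 * (norm (mob_den ?z))\<^sup>2 = (k * norm (mob_den ?z))\<^sup>2" by (simp add: power_mult_distrib)
  consider "norm x < 1" | "norm x \<ge> 1" by linarith
  then show ?thesis
  proof cases
    case 1
    then have M: "mob_den ?z \<noteq> 0" by (intro mob_den_nonzero) simp
    have "(norm x)\<^sup>2 < 1" using 1 by (simp add: abs_square_less_1)
    moreover have "k < norm (mob ?z) \<longleftrightarrow> k * norm (mob_den ?z) < norm (mob_num ?z)"
      using M by (simp add: mob_def norm_divide pos_less_divide_eq)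
    moreover have "k * norm (mob_den ?z) < norm (mob_num ?z) \<longleftrightarrow> (k * norm (mob_den ?z))\<^sup>2 < (norm (mob_num ?z))\<^sup>2"
      using k by (metis abs_le_square_iff abs_norm_cancel abs_of_nonneg less_imp_le mult_nonneg_nonneg norm_ge_zero not_le)
    ultimately show ?thesis using 1 by (simp add: exterior_def boundary_fun_def kM zero_less_mult_iff)
  next
    case 2
    have "(norm b)\<^sup>2 < 1" using b by (simp add: abs_square_less_1)
    moreover have "1 \<le> (norm ?z)\<^sup>2" using 2 by simp
    ultimately have "(norm (mob_den ?z))\<^sup>2 - (norm (mob_num ?z))\<^sup>2 \<le> 0"
      unfolding norm_mob_den_num by (intro mult_nonneg_nonpos) auto
    moreover have "k\<^sup>2 * (norm (mob_den ?z))\<^sup>2 \<le> 1 * (norm (mob_den ?z))\<^sup>2"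
      using k by (intro mult_right_mono) (auto simp: power_le_one)
    moreover have "(norm x)\<^sup>2 \<ge> 1" using 2 by simp
    ultimately have "boundary_fun x \<le> 0"
      unfolding boundary_fun_def by (intro mult_nonneg_nonpos; linarith)
    then show ?thesis using 2 by (simp add: exterior_def)
  qed
qed

lemma exterior_subset_closure: "exterior \<subseteq> exterior_closure"
  using mob_den_nonzero by (auto simp: exterior_def exterior_closure_def mob_def norm_divide pos_less_divide_eq)

lemma smooth_boundary_fun: "smooth_on boundary_fun UNIV"
proof -
  have "boundary_fun = (\<lambda>x. (Re (mob_num (cplx x) * cnj (mob_num (cplx x))) - k\<^sup>2 * Re (mob_den (cplx x) * cnj (mob_den (cplx x)))) *
      (1 - Re (cplx x * cnj (cplx x))))"
    by (auto simp: boundary_fun_def complex_norm_square[symmetric] simp flip: of_real_power norm_cplx)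
  moreover have "csmooth_on (\<lambda>z. mob_num z * cnj (mob_num z)) UNIV" "csmooth_on (\<lambda>z. mob_den z * cnj (mob_den z)) UNIV"
    "csmooth_on (\<lambda>z. z * cnj z) UNIV"
    unfolding mob_num_def mob_den_def by (intro csmooth_on_intros open_UNIV)+
  ultimately show ?thesis
    unfolding csmooth_on_def by (simp only:) (intro smooth_on_intros open_UNIV; blast)
qed

lemma open_exterior: "open exterior"
proof -
  have "exterior = {x. 0 < boundary_fun x}" using exterior_iff_boundary_fun by blast
  then show ?thesis
    using smooth_on_imp_continuous_on[OF smooth_boundary_fun] by (simp add: open_Collect_less)
qed

text \<open>A zero would force \<open>1 / cnj w\<close> and \<open>k\<^sup>2 / w\<^sup>3\<close> to have the same modulus, hence \<open>\<bar>w\<bar> = k\<close>.\<close>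

lemma flow_nonzero:
  assumes "x \<in> exterior"
  shows "flow x \<noteq> 0"
proof
  let ?w = "mob (cplx x)"
  assume "flow x = 0"
  then have "complex_flow (cplx x) = 0" by (metis complex_eqI flow_nth zero_complex.sel zero_index)
  have P: "x \<in> punctured" using assms exterior_subset_closure exterior_closure_punctured by blast
  have w: "?w \<noteq> 0" by (rule mob_nonzero[OF P])
  have n: "k < norm ?w" using assms by (simp add: exterior_def)
  have "(norm b)\<^sup>2 < 1" using b by (simp add: abs_square_less_1)
  then have "norm (dmob (cplx x)) > 0" using P by (simp add: norm_dmob punctured_def)
  moreover have "norm (?w * cnj ?w) \<noteq> norm (of_real k ^ 2 :: complex)"
    using power_strict_mono[OF n, of 2] k by (simp add: norm_mult norm_power power2_eq_square)
  moreover have "norm (inverse (cnj ?w)) \<noteq> norm (of_real k ^ 2 * inverse ?w ^ 3)"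
  proof
    assume "norm (inverse (cnj ?w)) = norm (of_real k ^ 2 * inverse ?w ^ 3)"
    then have "inverse (norm ?w) = k\<^sup>2 * inverse (norm ?w) ^ 3"
      by (simp add: norm_mult norm_power norm_inverse)
    then have "(norm ?w)\<^sup>2 = k\<^sup>2"
      using w by (simp add: field_simps power2_eq_square power3_eq_cube)
    then show False using n k by (simp add: power2_eq_iff_nonneg)
  qed
  ultimately show False
    using \<open>complex_flow (cplx x) = 0\<close> unfolding complex_flow_def flow_profile_def
    by (metis add_eq_0_iff eq_iff_diff_eq_0 mult_eq_0_iff norm_minus_cancel norm_zero order_less_irrefl zero_neq_numeral)
qed

lemma bounded_on_exterior_closure:
  assumes "smooth_on f punctured"
  shows "\<exists>C\<ge>0. \<forall>x\<in>exterior_closure. \<bar>f x\<bar> \<le> C"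
proof -
  have "bounded (f ` exterior_closure)"
    using assms exterior_closure_punctured smooth_on_imp_continuous_on
    by (intro compact_imp_bounded compact_continuous_image compact_exterior_closure) (blast intro: continuous_on_subset)
  then obtain C where "\<forall>x\<in>exterior_closure. \<bar>f x\<bar> \<le> C"
    unfolding bounded_iff by (metis imageI real_norm_def)
  then show ?thesis by (intro exI[of _ "max C 0"]) auto
qed

text \<open>This is the quantitative form of the boundary condition: the factor \<open>\<bar>w\<bar>\<^sup>2 - k\<^sup>2\<close> of the velocity is a bounded
multiple of the first factor of \<open>boundary_fun\<close>.\<close>

lemma flow_vanishing_order:
  "\<exists>C\<ge>0. \<forall>x\<in>exterior. \<forall>i. \<bar>flow x $ i\<bar> * (1 - (norm x)\<^sup>2) \<le> C * boundary_fun x"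
proof -
  define F where "F z = 2 * (cnj (inverse (mob z)) + of_real k ^ 2 * inverse (mob z) ^ 3) * dmob z / (mob_den z * cnj (mob_den z))" for z
  have csmooth_mob_den: "csmooth_on mob_den punctured"
    unfolding mob_den_def[abs_def] by (intro csmooth_on_intros open_punctured)
  have "csmooth_on F punctured"
    unfolding F_def[abs_def] using csmooth_mob_den
    by (intro csmooth_on_intros csmooth_inverse_mob csmooth_dmob open_punctured) (auto simp: punctured_def)
  then obtain C1 C2 where C: "\<And>x. x \<in> exterior_closure \<Longrightarrow> \<bar>Re (F (cplx x))\<bar> \<le> C1"
    "\<And>x. x \<in> exterior_closure \<Longrightarrow> \<bar>Im (F (cplx x))\<bar> \<le> C2" "C1 \<ge> 0" "C2 \<ge> 0"
    unfolding csmooth_on_def using bounded_on_exterior_closure by metis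
  show ?thesis
  proof (intro exI[of _ "C1 + C2"] conjI ballI allI)
    fix x i assume x: "x \<in> exterior"
    have M: "mob_den (cplx x) \<noteq> 0" and c: "x \<in> exterior_closure" using x exterior_subset_closure exterior_closure_punctured by (auto simp: punctured_def)
    let ?q = "(norm (mob_num (cplx x)))\<^sup>2 - k\<^sup>2 * (norm (mob_den (cplx x)))\<^sup>2"
    have nx: "1 - (norm x)\<^sup>2 > 0" using x by (simp add: exterior_def abs_square_less_1)
    have q: "?q > 0" using x nx unfolding exterior_iff_boundary_fun boundary_fun_def by (simp add: zero_less_mult_iff)
    have "?q / (norm (mob_den (cplx x)))\<^sup>2 = (norm (mob (cplx x)))\<^sup>2 - k\<^sup>2"
      using M by (simp add: mob_def norm_divide power_divide diff_divide_distrib)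
    from arg_cong[OF this, of complex_of_real]
    have "of_real ?q / (mob_den (cplx x) * cnj (mob_den (cplx x))) = mob (cplx x) * cnj (mob (cplx x)) - of_real k ^ 2"
      by (simp only: of_real_diff of_real_divide complex_norm_square[symmetric] of_real_power)
    note ww = this
    have E: "complex_flow (cplx x) = of_real ?q * F (cplx x)"
      unfolding complex_flow_def flow_profile_def F_def ww[symmetric] by (simp add: algebra_simps)
    have "\<bar>flow x $ i\<bar> \<le> ?q * (C1 + C2)"
    proof -
      have "\<bar>Re (F (cplx x))\<bar> \<le> C1 + C2" "\<bar>Im (F (cplx x))\<bar> \<le> C1 + C2" using C(1)[OF c] C(2)[OF c] C(3,4) by linarith+
      moreover have "Re (complex_flow (cplx x)) = ?q * Re (F (cplx x))" "Im (complex_flow (cplx x)) = ?q * Im (F (cplx x))"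
        unfolding E by simp_all
      ultimately show ?thesis
        using q exhaust_2[of i] by (auto simp: abs_mult intro!: mult_mono)
    qed
    then have "\<bar>flow x $ i\<bar> * (1 - (norm x)\<^sup>2) \<le> ?q * (C1 + C2) * (1 - (norm x)\<^sup>2)"
      using nx by (intro mult_right_mono) auto
    then show "\<bar>flow x $ i\<bar> * (1 - (norm x)\<^sup>2) \<le> (C1 + C2) * boundary_fun x" by (simp add: boundary_fun_def mult_ac)
  qed (use C in auto)
qed

end

section \<open>The hyperbolic metric\<close>

lemma inv_factor_nonneg: "0 \<le> inv_factor a x"
  by (simp add: inv_factor_def)

lemma norm_less_1_sq: "norm x < 1 \<Longrightarrow> (norm x)\<^sup>2 < 1"
  by (simp add: abs_square_less_1)

lemma inv_factor_pos: "a > 0 \<Longrightarrow> norm x < 1 \<Longrightarrow> 0 < inv_factor a x"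
  using norm_less_1_sq[of x] by (simp add: inv_factor_def)

lemma hyp_metric_inv_factor: "hyp_metric a x = mat (inverse (inv_factor a x))"
  by (simp add: hyp_metric_def inv_factor_def)

lemma matrix_inv_mat:
  assumes "c \<noteq> 0"
  shows "matrix_inv (mat c :: real^'n^'n) = mat (inverse c)"
proof -
  have m: "(mat c :: real^'n^'n) ** mat d = mat (c * d)" for c d
    by (auto simp: matrix_matrix_mult_def mat_def vec_eq_iff if_distrib cong: if_cong intro!: sum.neutral)
  have *: "(mat c :: real^'n^'n) ** mat (inverse c) = mat 1" "(mat (inverse c) :: real^'n^'n) ** mat c = mat 1"
    using assms by (simp_all add: m)
  then have "matrix_inv (mat c :: real^'n^'n) ** mat c = mat 1"
    unfolding matrix_inv_def by (metis (mono_tags, lifting) someI_ex)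
  then show ?thesis
    using *(1) by (metis matrix_mul_assoc matrix_mul_lid matrix_mul_rid)
qed

lemma ginv_hyp_metric:
  assumes "a > 0" "norm x < 1"
  shows "ginv (hyp_metric a) x i j = (if i = j then inv_factor a x else 0)"
  using inv_factor_pos[OF assms] unfolding ginv_def hyp_metric_inv_factor
  by (subst matrix_inv_mat) (simp_all add: mat_def)

lemma vol_density_hyp_metric: "vol_density (hyp_metric a) x = inverse (inv_factor a x)"
  using inv_factor_nonneg[of a x]
  by (simp add: vol_density_def hyp_metric_inv_factor det_2 mat_def real_sqrt_mult_self)

lemma form_inner_hyp_metric:
  assumes "a > 0" "norm x < 1"
  shows "form_inner (hyp_metric a) x \<alpha> \<beta> = inv_factor a x * (\<alpha> \<bullet> \<beta>)"
  using assms by (simp add: form_inner_def ginv_hyp_metric sum_2 inner_vec_def distrib_left)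

lemma tensor_inner_hyp_metric:
  assumes "a > 0" "norm x < 1"
  shows "tensor_inner (hyp_metric a) x A A = (inv_factor a x)\<^sup>2 * (\<Sum>i\<in>UNIV. \<Sum>j\<in>UNIV. (A $ i $ j)\<^sup>2)"
  using assms by (simp add: tensor_inner_def ginv_hyp_metric sum_2 power2_eq_square algebra_simps)

section \<open>Geodesic discs\<close>

lemma tanh_artanh_real:
  assumes "\<bar>x\<bar> < 1"
  shows "tanh (artanh x) = (x::real)"
proof -
  have "exp (- 2 * artanh x) = (1 - x) / (1 + x)"
    using assms by (simp add: artanh_def exp_minus)
  then show ?thesis using assms unfolding tanh_real_altdef by (simp only:) (simp add: field_simps)
qed

lemma curve_length_hyp_metric:
  assumes "a > 0" "\<gamma> ` {0..1} \<subseteq> hyp_plane"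
    "\<And>t. t \<in> {0..1} \<Longrightarrow> (\<gamma> has_vector_derivative \<gamma>' t) (at t)"
  shows "curve_length (hyp_metric a) \<gamma> =
    integral {0..1} (\<lambda>t. 2 / a * (norm (\<gamma>' t) / (1 - (norm (\<gamma> t))\<^sup>2)))"
  unfolding curve_length_def
proof (rule Henstock_Kurzweil_Integration.integral_cong)
  fix t :: real assume t: "t \<in> {0..1}"
  have d: "vector_derivative \<gamma> (at t) = \<gamma>' t" using assms(3)[OF t] by (rule vector_derivative_at)
  have "\<gamma> t \<in> hyp_plane" using assms(2) t by blast
  then have n: "norm (\<gamma> t) < 1" by (simp add: hyp_plane_def)
  have "inv_factor a (\<gamma> t) = (a * (1 - (norm (\<gamma> t))\<^sup>2) / 2)\<^sup>2"
    by (simp add: inv_factor_def power_divide power_mult_distrib)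
  moreover have "a * (1 - (norm (\<gamma> t))\<^sup>2) / 2 \<ge> 0"
    using \<open>a > 0\<close> norm_less_1_sq[OF n] by simp
  ultimately have s: "sqrt (inv_factor a (\<gamma> t)) = a * (1 - (norm (\<gamma> t))\<^sup>2) / 2"
    by (metis real_sqrt_unique)
  have "(\<Sum>i\<in>UNIV. \<Sum>j\<in>UNIV. hyp_metric a (\<gamma> t) $ i $ j * \<gamma>' t $ i * \<gamma>' t $ j)
      = inverse (inv_factor a (\<gamma> t)) * (norm (\<gamma>' t))\<^sup>2"
    by (simp add: hyp_metric_inv_factor mat_def sum_2 power2_norm_eq_inner inner_vec_def distrib_left)
  then have "sqrt (\<Sum>i\<in>UNIV. \<Sum>j\<in>UNIV. hyp_metric a (\<gamma> t) $ i $ j * \<gamma>' t $ i * \<gamma>' t $ j)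
      = norm (\<gamma>' t) / (a * (1 - (norm (\<gamma> t))\<^sup>2) / 2)"
    by (simp only: real_sqrt_mult real_sqrt_inverse real_sqrt_abs abs_norm_cancel s divide_inverse mult.commute[of "norm (\<gamma>' t)"])
  then show "sqrt (\<Sum>i\<in>UNIV. \<Sum>j\<in>UNIV. hyp_metric a (\<gamma> t) $ i $ j *
       vector_derivative \<gamma> (at t) $ i * vector_derivative \<gamma> (at t) $ j) =
      2 / a * (norm (\<gamma>' t) / (1 - (norm (\<gamma> t))\<^sup>2))"
    unfolding d by simp
qed

context disc_point
begin

lemma norm_mob_less_1: "norm z < 1 \<Longrightarrow> norm (mob z) < 1"
proof -
  assume z: "norm z < 1"
  have "norm b * norm b < 1" using b mult_strict_mono[of "norm b" 1 "norm b" 1] by simp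
  then have "norm (dmob z) * (1 - (norm z)\<^sup>2) > 0"
    using z mob_den_nonzero[of z] norm_less_1_sq[of z] by (simp add: norm_dmob power2_eq_square)
  then have "(norm (mob z))\<^sup>2 < 1" using mob_conformal[OF mob_den_nonzero, of z] z by simp
  then show ?thesis by (simp add: abs_square_less_1)
qed

text \<open>Let \<open>e\<close> be the direction of the end point in the coordinate \<open>w = mob z\<close>. Along the curve the function
\<open>artanh (Re (cnj e w))\<close> grows at most with hyperbolic speed, and at the ends it agrees with \<open>artanh \<bar>w\<bar>\<close>. Unlike
\<open>artanh \<bar>w\<bar>\<close> it is differentiable also where the curve passes through the centre.\<close>

lemma artanh_mob_le_curve_length:
  assumes "a > 0" "\<gamma> C1_differentiable_on {0..1}" "\<gamma> ` {0..1} \<subseteq> hyp_plane" "cplx (\<gamma> 0) = b"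
  shows "2 / a * artanh (norm (mob (cplx (\<gamma> 1)))) \<le> curve_length (hyp_metric a) \<gamma>"
proof -
  obtain \<gamma>' where d: "\<And>t. t \<in> {0..1} \<Longrightarrow> (\<gamma> has_vector_derivative \<gamma>' t) (at t)"
    and c: "continuous_on {0..1} \<gamma>'"
    using assms(2) unfolding C1_differentiable_on_def by blast
  let ?w = "\<lambda>t. mob (cplx (\<gamma> t))"
  \<comment> \<open>if the curve returns to the centre then \<open>e = 0\<close>, and the estimate below says only that lengths are nonnegative\<close>
  define e where "e = sgn (?w 1)"
  define f where "f t = Re (cnj e * ?w t)" for t
  define f' where "f' t = Re (cnj e * (dmob (cplx (\<gamma> t)) * cplx (\<gamma>' t)))" for t
  define q where "q t = norm (\<gamma>' t) / (1 - (norm (\<gamma> t))\<^sup>2)" for t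
  have e: "norm e \<le> 1" by (simp add: e_def norm_sgn)
  have n: "norm (\<gamma> t) < 1" if "t \<in> {0..1}" for t
  proof -
    have "\<gamma> t \<in> hyp_plane" using assms(3) that by blast
    then show ?thesis by (simp add: hyp_plane_def)
  qed
  have fw: "\<bar>f t\<bar> \<le> norm (?w t)" for t
  proof -
    have "\<bar>f t\<bar> \<le> norm e * norm (?w t)"
      unfolding f_def by (metis abs_Re_le_cmod complex_mod_cnj norm_mult)
    also have "\<dots> \<le> 1 * norm (?w t)" using e by (rule mult_right_mono) simp
    finally show ?thesis by simp
  qed
  have f1: "\<bar>f t\<bar> < 1" if "t \<in> {0..1}" for t
    using fw[of t] norm_mob_less_1[of "cplx (\<gamma> t)"] n[OF that] by simp
  have df: "(f has_real_derivative f' t) (at t)" if t: "t \<in> {0..1}" for t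
  proof -
    have M: "mob_den (cplx (\<gamma> t)) \<noteq> 0" using n[OF t] by (intro mob_den_nonzero) simp
    have "((\<lambda>t. cplx (\<gamma> t)) has_vector_derivative cplx (\<gamma>' t)) (at t)"
      using bounded_linear.has_vector_derivative[OF bounded_linear_cplx d[OF t]] .
    then have "(?w has_vector_derivative cplx (\<gamma>' t) * dmob (cplx (\<gamma> t))) (at t)"
      using field_vector_diff_chain_at[of "\<lambda>t. cplx (\<gamma> t)" _ t mob] mob_has_field_derivative[OF M] by (simp add: o_def)
    from bounded_linear.has_vector_derivative[OF bounded_linear_compose[OF bounded_linear_Re bounded_linear_mult_right[of "cnj e"]] this]
    show ?thesis unfolding f_def[abs_def] f'_def has_real_derivative_iff_has_vector_derivative
      by (simp add: mult.commute)
  qed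
  have "((\<lambda>t. 1 / (1 - (f t)\<^sup>2) * f' t) has_integral (artanh (f 1) - artanh (f 0))) {0..1}"
  proof (rule fundamental_theorem_of_calculus)
    fix t :: real assume t: "t \<in> {0..1}"
    from DERIV_chain2[OF artanh_real_has_field_derivative[OF f1[OF t], of UNIV] df[OF t]]
    show "((\<lambda>t. artanh (f t)) has_vector_derivative 1 / (1 - (f t)\<^sup>2) * f' t) (at t within {0..1})"
      using has_real_derivative_iff_has_vector_derivative has_vector_derivative_at_within by blast
  qed simp
  moreover have "f 0 = 0" by (simp add: f_def assms(4) mob_def mob_num_def)
  moreover have "f 1 = norm (?w 1)"
  proof -
    have "cnj e * ?w 1 = of_real (norm (?w 1))"
      by (simp add: e_def sgn_eq complex_norm_square[symmetric] power2_eq_square mult.commute)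
    then show ?thesis by (simp add: f_def)
  qed
  ultimately have I: "((\<lambda>t. 1 / (1 - (f t)\<^sup>2) * f' t) has_integral artanh (norm (?w 1))) {0..1}" by simp
  have "continuous_on {0..1} \<gamma>"
    using d by (meson continuous_at_imp_continuous_on has_vector_derivative_continuous)
  moreover have "1 - (norm (\<gamma> t))\<^sup>2 \<noteq> 0" if "t \<in> {0..1}" for t
    using norm_less_1_sq[OF n[OF that]] by simp
  ultimately have "continuous_on {0..1} q"
    unfolding q_def using c by (intro continuous_intros) auto
  then have Q: "(q has_integral integral {0..1} q) {0..1}"
    using integrable_continuous_real by blast
  have "artanh (norm (?w 1)) \<le> integral {0..1} q"
  proof (rule has_integral_le[OF I Q])
    fix t :: real assume t: "t \<in> {0..1}"
    let ?z = "cplx (\<gamma> t)"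
    have M: "mob_den ?z \<noteq> 0" using n[OF t] by (intro mob_den_nonzero) simp
    have c: "1 - (norm (?w t))\<^sup>2 = norm (dmob ?z) * (1 - (norm (\<gamma> t))\<^sup>2)"
      using mob_conformal[OF M] by simp
    have pos: "1 - (norm (?w t))\<^sup>2 > 0" using norm_less_1_sq[OF norm_mob_less_1[of ?z]] n[OF t] by simp
    have "(f t)\<^sup>2 \<le> (norm (?w t))\<^sup>2" using fw[of t] by (simp add: abs_le_square_iff[symmetric])
    then have "1 - (norm (?w t))\<^sup>2 \<le> 1 - (f t)\<^sup>2" by simp
    have "\<bar>f' t\<bar> \<le> norm e * (norm (dmob ?z) * norm (\<gamma>' t))"
      unfolding f'_def by (metis abs_Re_le_cmod complex_mod_cnj norm_cplx norm_mult)
    also have "\<dots> \<le> 1 * (norm (dmob ?z) * norm (\<gamma>' t))" using e by (intro mult_right_mono) auto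
    finally have f': "f' t \<le> norm (dmob ?z) * norm (\<gamma>' t)" by simp
    have "1 / (1 - (f t)\<^sup>2) * f' t = f' t / (1 - (f t)\<^sup>2)" by simp
    also have "\<dots> \<le> norm (dmob ?z) * norm (\<gamma>' t) / (1 - (norm (?w t))\<^sup>2)"
      using f' pos \<open>1 - (norm (?w t))\<^sup>2 \<le> 1 - (f t)\<^sup>2\<close> by (intro frac_le) auto
    also have "\<dots> = q t" using pos unfolding c q_def by (auto simp: zero_less_mult_iff)
    finally show "1 / (1 - (f t)\<^sup>2) * f' t \<le> q t" .
  qed
  then have "2 / a * artanh (norm (?w 1)) \<le> 2 / a * integral {0..1} q"
    using \<open>a > 0\<close> by (intro mult_left_mono) auto
  also have "\<dots> = curve_length (hyp_metric a) \<gamma>"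
  proof -
    have "curve_length (hyp_metric a) \<gamma> = integral {0..1} (\<lambda>t. 2 / a * q t)"
      unfolding q_def by (rule curve_length_hyp_metric[OF \<open>a > 0\<close> assms(3) d])
    also have "\<dots> = 2 / a * integral {0..1} q" by (rule integral_mult_right)
    finally show ?thesis ..
  qed
  finally show ?thesis .
qed

definition mob_inv :: "complex \<Rightarrow> complex" where "mob_inv w = (w + b) / (1 + cnj b * w)"

lemma denominator_mob_inv: "norm w < 1 \<Longrightarrow> 1 + cnj b * w \<noteq> 0"
proof
  assume "norm w < 1" "1 + cnj b * w = 0"
  then have "norm (cnj b * w) = 1" by (metis add_eq_0_iff norm_minus_cancel norm_one)
  moreover have "norm b * norm w \<le> norm b * 1" using \<open>norm w < 1\<close> by (intro mult_left_mono) auto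
  ultimately show False using b by (simp add: norm_mult)
qed

lemma one_minus_b_cnj_b: "1 - b * cnj b \<noteq> 0"
proof
  assume "1 - b * cnj b = 0"
  then have "of_real ((norm b)\<^sup>2) = (1::complex)" unfolding complex_norm_square by simp
  then show False using norm_less_1_sq[OF b] by (simp only: of_real_eq_1_iff)
qed

lemma mob_den_mob_inv:
  assumes "norm w < 1"
  shows "mob_den (mob_inv w) = (1 - b * cnj b) / (1 + cnj b * w)"
  using denominator_mob_inv[OF assms] by (simp add: mob_den_def mob_inv_def field_simps)

lemma mob_mob_inv:
  assumes "norm w < 1"
  shows "mob (mob_inv w) = w"
proof -
  have "mob_num (mob_inv w) = w * (1 - b * cnj b) / (1 + cnj b * w)"
    using denominator_mob_inv[OF assms] by (simp add: mob_num_def mob_inv_def field_simps)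
  then show ?thesis
    using denominator_mob_inv[OF assms] one_minus_b_cnj_b by (simp add: mob_def mob_den_mob_inv[OF assms])
qed

lemma norm_mob_inv_less_1:
  assumes "norm w < 1"
  shows "norm (mob_inv w) < 1"
proof -
  have M: "mob_den (mob_inv w) \<noteq> 0"
    using denominator_mob_inv[OF assms] one_minus_b_cnj_b by (simp add: mob_den_mob_inv[OF assms])
  have "norm (dmob (mob_inv w)) * (1 - (norm (mob_inv w))\<^sup>2) > 0"
    using mob_conformal[OF M] norm_less_1_sq[OF assms] by (simp add: mob_mob_inv[OF assms])
  then have "(norm (mob_inv w))\<^sup>2 < 1" by (simp add: zero_less_mult_iff)
  then show ?thesis by (simp add: abs_square_less_1)
qed

lemma mob_inv_mob:
  assumes "norm z < 1"
  shows "mob_inv (mob z) = z"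
proof -
  have M: "mob_den z \<noteq> 0" using mob_den_nonzero assms by simp
  have "mob z + b = z * (1 - b * cnj b) / mob_den z" "1 + cnj b * mob z = (1 - b * cnj b) / mob_den z"
    using M by (simp_all add: mob_def mob_num_def field_simps) (simp_all add: mob_den_def algebra_simps)
  then show ?thesis using M one_minus_b_cnj_b by (simp add: mob_inv_def)
qed

text \<open>The minimising curve is the preimage of a straight segment from the origin under the isometry \<open>mob\<close>.\<close>

lemma ex_curve_length_eq_artanh_mob:
  assumes "a > 0" "norm x < 1" "cplx P = b"
  shows "\<exists>\<gamma>. \<gamma> C1_differentiable_on {0..1} \<and> \<gamma> ` {0..1} \<subseteq> hyp_plane \<and> \<gamma> 0 = P \<and> \<gamma> 1 = x \<and>
    curve_length (hyp_metric a) \<gamma> = 2 / a * artanh (norm (mob (cplx x)))"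
proof -
  define w0 where "w0 = mob (cplx x)"
  have w0: "norm w0 < 1" unfolding w0_def using assms by (intro norm_mob_less_1) simp
  define g where "g t = mob_inv (of_real t * w0)" for t
  define g' where "g' t = (1 - b * cnj b) / (1 + cnj b * (of_real t * w0))\<^sup>2 * w0" for t :: real
  define \<gamma> where "\<gamma> t = (vector [Re (g t), Im (g t)] :: real^2)" for t
  define \<gamma>' where "\<gamma>' t = (vector [Re (g' t), Im (g' t)] :: real^2)" for t
  have inv: "x = vector [Re (cplx x), Im (cplx x)]" for x :: "real^2"
    by (simp add: vec_eq_iff forall_2)
  have norm_v: "norm (vector [Re z, Im z] :: real^2) = norm z" for z
    by (simp flip: norm_cplx)
  have bl: "bounded_linear (\<lambda>z. vector [Re z, Im z] :: real^2)"
    by (rule bounded_linear_intro[where K = 1]) (auto simp: vec_eq_iff forall_2 norm_v)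
  have tw: "norm (of_real t * w0) < 1" if "t \<in> {0..1}" for t :: real
  proof -
    have "t * norm w0 \<le> 1 * norm w0" using that by (intro mult_right_mono) auto
    then show ?thesis using w0 that by (simp add: norm_mult)
  qed
  note den = denominator_mob_inv[OF tw]
  have dg: "(g has_vector_derivative g' t) (at t)" if t: "t \<in> {0..1}" for t
  proof -
    have "((\<lambda>s. mob_inv (s * w0)) has_field_derivative g' t) (at (of_real t))"
      using den[OF t] unfolding mob_inv_def g'_def
      by (auto intro!: derivative_eq_intros simp: divide_simps) (simp add: algebra_simps power2_eq_square)
    then show ?thesis unfolding g_def by (rule has_vector_derivative_real_field)
  qed
  have d: "(\<gamma> has_vector_derivative \<gamma>' t) (at t)" if "t \<in> {0..1}" for t
    using bounded_linear.has_vector_derivative[OF bl dg[OF that]] unfolding \<gamma>_def[abs_def] \<gamma>'_def .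
  have cg': "continuous_on {0..1} g'"
    unfolding g'_def using den by (intro continuous_intros) auto
  have c: "continuous_on {0..1} \<gamma>'"
    unfolding \<gamma>'_def[abs_def]
    by (rule linear_continuous_on_compose[OF cg']) (rule bounded_linear.linear[OF bl])
  have sub: "\<gamma> ` {0..1} \<subseteq> hyp_plane"
    using norm_mob_inv_less_1[OF tw] by (auto simp: hyp_plane_def \<gamma>_def norm_v g_def)
  have "g 0 = b" by (simp add: g_def mob_inv_def)
  then have "\<gamma> 0 = P" using inv[of P] unfolding \<gamma>_def assms(3) by simp
  have "\<gamma> 1 = x" using inv[of x] assms(2) by (simp add: \<gamma>_def g_def w0_def mob_inv_mob)
  have "curve_length (hyp_metric a) \<gamma> = integral {0..1} (\<lambda>t. 2 / a * (norm (\<gamma>' t) / (1 - (norm (\<gamma> t))\<^sup>2)))"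
    by (rule curve_length_hyp_metric[OF \<open>a > 0\<close> sub d])
  also have "\<dots> = 2 / a * integral {0..1} (\<lambda>t. norm (\<gamma>' t) / (1 - (norm (\<gamma> t))\<^sup>2))"
    by (rule integral_mult_right)
  also have "integral {0..1} (\<lambda>t. norm (\<gamma>' t) / (1 - (norm (\<gamma> t))\<^sup>2))
      = integral {0..1} (\<lambda>t. 1 / (1 - (t * norm w0)\<^sup>2) * norm w0)"
  proof (rule Henstock_Kurzweil_Integration.integral_cong)
    fix t :: real assume t: "t \<in> {0..1}"
    have M: "mob_den (g t) \<noteq> 0" unfolding g_def
      using denominator_mob_inv[OF tw[OF t]] one_minus_b_cnj_b by (simp add: mob_den_mob_inv[OF tw[OF t]])
    have D: "dmob (g t) * g' t = w0"
      using den[OF t] one_minus_b_cnj_b unfolding dmob_def g_def mob_den_mob_inv[OF tw[OF t]] g'_def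
      by (simp add: power2_eq_square)
    have "norm (dmob (g t)) * (1 - (norm (g t))\<^sup>2) = 1 - (t * norm w0)\<^sup>2"
      using mob_conformal[OF M] t unfolding g_def mob_mob_inv[OF tw[OF t]] by (simp add: norm_mult)
    moreover have "norm (dmob (g t)) * norm (g' t) = norm w0" using D by (metis norm_mult)
    moreover have "norm (dmob (g t)) \<noteq> 0"
      using M one_minus_b_cnj_b by (simp add: dmob_def)
    ultimately have "norm (g' t) / (1 - (norm (g t))\<^sup>2) = norm w0 / (1 - (t * norm w0)\<^sup>2)"
      by (metis mult_divide_mult_cancel_left)
    then show "norm (\<gamma>' t) / (1 - (norm (\<gamma> t))\<^sup>2) = 1 / (1 - (t * norm w0)\<^sup>2) * norm w0"
      by (simp add: \<gamma>_def \<gamma>'_def norm_v)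
  qed
  also have "\<dots> = artanh (1 * norm w0) - artanh (0 * norm w0)"
  proof (rule integral_unique, rule fundamental_theorem_of_calculus)
    fix t :: real assume t: "t \<in> {0..1}"
    have "\<bar>t * norm w0\<bar> < 1" using tw[OF t] by (simp add: norm_mult abs_mult)
    note dr = DERIV_chain2[where f = artanh and g = "\<lambda>t. t * norm w0",
        OF artanh_real_has_field_derivative[OF this, of UNIV]]
    have "((\<lambda>t. t * norm w0) has_real_derivative norm w0) (at t)" by (auto intro!: derivative_eq_intros)
    from dr[OF this]
    show "((\<lambda>t. artanh (t * norm w0)) has_vector_derivative 1 / (1 - (t * norm w0)\<^sup>2) * norm w0) (at t within {0..1})"
      using has_real_derivative_iff_has_vector_derivative has_vector_derivative_at_within by blast
  qed simp
  finally have "curve_length (hyp_metric a) \<gamma> = 2 / a * artanh (norm (mob (cplx x)))"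
    by (simp add: w0_def)
  then show ?thesis
    using c d sub \<open>\<gamma> 0 = P\<close> \<open>\<gamma> 1 = x\<close> unfolding C1_differentiable_on_def by blast
qed

lemma geodesic_dist_hyp_metric:
  assumes "a > 0" "norm x < 1" "cplx P = b"
  shows "geodesic_dist (hyp_metric a) hyp_plane P x = 2 / a * artanh (norm (mob (cplx x)))"
  unfolding geodesic_dist_def
proof (rule cInf_eq_minimum)
  show "2 / a * artanh (norm (mob (cplx x))) \<in> {curve_length (hyp_metric a) \<gamma> |\<gamma>.
     \<gamma> C1_differentiable_on {0..1} \<and> \<gamma> ` {0..1} \<subseteq> hyp_plane \<and> \<gamma> 0 = P \<and> \<gamma> 1 = x}"
    using ex_curve_length_eq_artanh_mob[OF assms] by (metis (mono_tags, lifting) mem_Collect_eq)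
qed (use artanh_mob_le_curve_length[OF assms(1)] assms(3) in auto)

end

lemma (in exterior_flow) hyp_exterior_eq_exterior:
  assumes "cplx P = b" "k = tanh (a * R / 2)"
  shows "hyp_exterior a P R = exterior"
proof -
  have "geodesic_dist (hyp_metric a) hyp_plane P x > R \<longleftrightarrow> k < norm (mob (cplx x))" if x: "norm x < 1" for x
  proof -
    have w: "norm (mob (cplx x)) < 1" using x by (intro norm_mob_less_1) simp
    have t: "tanh (artanh (norm (mob (cplx x)))) = norm (mob (cplx x))"
      using w by (intro tanh_artanh_real) auto
    have "geodesic_dist (hyp_metric a) hyp_plane P x > R \<longleftrightarrow> a * R / 2 < artanh (norm (mob (cplx x)))"
      unfolding geodesic_dist_hyp_metric[OF a x assms(1)] using a by (simp add: field_simps)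
    also have "\<dots> \<longleftrightarrow> k < norm (mob (cplx x))"
      using tanh_real_less_iff[of "a * R / 2" "artanh (norm (mob (cplx x)))"] unfolding t assms(2) by simp
    finally show ?thesis .
  qed
  then show ?thesis by (auto simp: hyp_exterior_def exterior_def hyp_plane_def)
qed

section \<open>Weak operators on a domain of the disc\<close>

locale hyp_domain =
  fixes a :: real and U :: "(real^2) set"
  assumes a_pos: "a > 0" and open_U: "open U" and U_disc: "U \<subseteq> hyp_plane"
begin

abbreviation "g \<equiv> hyp_metric a"

lemma norm_less_1: "x \<in> U \<Longrightarrow> norm x < 1"
  using U_disc by (auto simp: hyp_plane_def)

lemma one_minus_norm_sq_pos: "x \<in> U \<Longrightarrow> 1 - (norm x)\<^sup>2 > 0"
  using norm_less_1_sq[OF norm_less_1] by simp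

lemma inv_factor_pos_U: "x \<in> U \<Longrightarrow> inv_factor a x > 0"
  using inv_factor_pos[OF a_pos norm_less_1] .

lemma U_sets: "U \<in> sets lebesgue"
  using open_U by simp

lemma finite_measure_U: "finite_measure (lebesgue_on U)"
proof (rule finite_measure_lebesgue_on)
  have "bounded U" using U_disc bounded_subset[of "ball 0 1"] by (auto simp: hyp_plane_def)
  then show "U \<in> lmeasurable" using open_U by (simp add: lmeasurable_open)
qed

lemma measurable_continuous: "continuous_on U f \<Longrightarrow> f \<in> borel_measurable (lebesgue_on U)"
  using continuous_imp_measurable_on_sets_lebesgue U_sets by blast

lemma smooth_norm_sq: "smooth_on (\<lambda>x::real^2. (norm x)\<^sup>2) V"
proof -
  have "smooth_on (\<lambda>x::real^2. (norm x)\<^sup>2) UNIV"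
    by (simp add: power2_norm_eq_inner inner_vec_def sum_2 smooth_on_intros)
  then show ?thesis by (rule smooth_on_subset) simp
qed

lemma smooth_inv_factor: "smooth_on (inv_factor a) UNIV"
  unfolding inv_factor_def[abs_def] by (intro smooth_on_intros smooth_norm_sq open_UNIV) simp

lemma continuous_inv_factor: "continuous_on S (inv_factor a)"
  using smooth_on_imp_continuous_on[OF smooth_inv_factor] continuous_on_subset by blast

text \<open>For the inner product of 1-forms \<open>h\<close> is the Euclidean one: in dimension two the inverse metric and the volume
density cancel. For general \<open>f\<close> one integrates \<open>f\<close> divided by \<open>inv_factor\<close>.\<close>

lemma
  assumes "\<And>x. x \<in> U \<Longrightarrow> f x = inv_factor a x * h x" and h: "h \<in> borel_measurable (lebesgue_on U)"
  shows vol_integral: "(LINT x|vol g U. f x) = (LINT x|lebesgue_on U. h x)"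
    and vol_integrable: "integrable (vol g U) f \<longleftrightarrow> integrable (lebesgue_on U) h"
proof -
  let ?d = "\<lambda>x. inverse (inv_factor a x)"
  have v: "vol g U = density (lebesgue_on U) (\<lambda>x. ennreal (?d x))"
    by (simp add: vol_def vol_density_hyp_metric)
  have c: "inv_factor a \<in> borel_measurable (lebesgue_on U)" "?d \<in> borel_measurable (lebesgue_on U)"
    using measurable_continuous[OF continuous_inv_factor] by (auto intro: borel_measurable_inverse)
  have f: "f \<in> borel_measurable (lebesgue_on U)"
    by (subst measurable_cong[where g = "\<lambda>x. inv_factor a x * h x"]) (use assms c in auto)
  have d: "?d x *\<^sub>R f x = h x" if "x \<in> U" for x
    using assms(1)[OF that] inv_factor_pos_U[OF that] by simp
  have ae: "AE x in lebesgue_on U. 0 \<le> ?d x" by (simp add: inv_factor_nonneg)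
  show "(LINT x|vol g U. f x) = (LINT x|lebesgue_on U. h x)"
    unfolding v integral_density[OF f c(2) ae]
    by (rule Bochner_Integration.integral_cong) (auto simp: d[simplified])
  show "integrable (vol g U) f \<longleftrightarrow> integrable (lebesgue_on U) h"
    unfolding v integrable_density[OF f c(2) ae]
    by (rule Bochner_Integration.integrable_cong) (auto simp: d[simplified])
qed

lemma codiff1_hyp_metric:
  assumes "x \<in> U"
  shows "codiff1 g \<phi> x = - (inv_factor a x * (partial 1 (\<lambda>y. \<phi> y $ 1) x + partial 2 (\<lambda>y. \<phi> y $ 2) x))"
proof -
  have "partial i (\<lambda>y. vol_density g y * (\<Sum>j\<in>UNIV. ginv g y i j * \<phi> y $ j)) x = partial i (\<lambda>y. \<phi> y $ i) x" for i
  proof (rule partial_cong_open[OF open_U assms])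
    fix y assume y: "y \<in> U"
    have "(\<Sum>j\<in>UNIV. ginv g y i j * \<phi> y $ j) = inv_factor a y * \<phi> y $ i"
      using exhaust_2[of i] by (auto simp: ginv_hyp_metric[OF a_pos norm_less_1[OF y]] sum_2)
    then show "vol_density g y * (\<Sum>j\<in>UNIV. ginv g y i j * \<phi> y $ j) = \<phi> y $ i"
      using inv_factor_pos_U[OF y] by (simp add: vol_density_hyp_metric)
  qed
  then show ?thesis by (simp add: codiff1_def vol_density_hyp_metric sum_2 divide_inverse)
qed

abbreviation curl :: "(real^2 \<Rightarrow> real^2) \<Rightarrow> real^2 \<Rightarrow> real" where
  "curl \<phi> x \<equiv> partial 1 (\<lambda>y. \<phi> y $ 2) x - partial 2 (\<lambda>y. \<phi> y $ 1) x"

abbreviation divergence :: "(real^2 \<Rightarrow> real^2) \<Rightarrow> real^2 \<Rightarrow> real" where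
  "divergence \<phi> x \<equiv> partial 1 (\<lambda>y. \<phi> y $ 1) x + partial 2 (\<lambda>y. \<phi> y $ 2) x"

lemma codiff2_hyp_metric:
  assumes "x \<in> U" and c: "(\<lambda>y. inv_factor a y * curl \<phi> y) differentiable (at x)"
  shows "codiff2 g (ext_deriv1 \<phi>) x $ 1 = partial 2 (\<lambda>y. inv_factor a y * curl \<phi> y) x"
    and "codiff2 g (ext_deriv1 \<phi>) x $ 2 = - partial 1 (\<lambda>y. inv_factor a y * curl \<phi> y) x"
proof -
  let ?F = "\<lambda>i j y. vol_density g y *
      (\<Sum>k\<in>UNIV. \<Sum>l\<in>UNIV. ginv g y i k * ginv g y j l * ext_deriv1 \<phi> y $ k $ l)"
  have F: "?F i j y = inv_factor a y * ext_deriv1 \<phi> y $ i $ j" if y: "y \<in> U" for i j y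
  proof -
    have "(\<Sum>k\<in>UNIV. \<Sum>l\<in>UNIV. ginv g y i k * ginv g y j l * ext_deriv1 \<phi> y $ k $ l)
        = inv_factor a y * (inv_factor a y * ext_deriv1 \<phi> y $ i $ j)"
      using exhaust_2[of i] exhaust_2[of j]
      by (auto simp: ginv_hyp_metric[OF a_pos norm_less_1[OF y]] sum_2)
    then show ?thesis using inv_factor_pos_U[OF y] by (simp add: vol_density_hyp_metric)
  qed
  have p0: "partial i (?F i i) x = 0" for i
  proof -
    have "partial i (?F i i) x = partial i (\<lambda>_. 0) x"
    proof (rule partial_cong_open[OF open_U assms(1)])
      show "?F i i y = 0" if "y \<in> U" for y unfolding F[OF that] by (simp add: ext_deriv1_def)
    qed
    then show ?thesis by simp
  qed
  have p12: "partial 1 (?F 1 2) x = partial 1 (\<lambda>y. inv_factor a y * curl \<phi> y) x"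
  proof (rule partial_cong_open[OF open_U assms(1)])
    show "?F 1 2 y = inv_factor a y * curl \<phi> y" if "y \<in> U" for y unfolding F[OF that] by (simp add: ext_deriv1_def)
  qed
  have "partial 2 (?F 2 1) x = partial 2 (\<lambda>y. (- 1) * (inv_factor a y * curl \<phi> y)) x"
  proof (rule partial_cong_open[OF open_U assms(1)])
    show "?F 2 1 y = (- 1) * (inv_factor a y * curl \<phi> y)" if "y \<in> U" for y
      unfolding F[OF that] by (simp add: ext_deriv1_def algebra_simps)
  qed
  then have p21: "partial 2 (?F 2 1) x = - partial 2 (\<lambda>y. inv_factor a y * curl \<phi> y) x"
    unfolding partial_cmult[OF c] by simp
  have G: "g x $ m $ j = (if m = j then inverse (inv_factor a x) else 0)" for m j
    by (simp add: hyp_metric_inv_factor mat_def)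
  have cc: "codiff2 g (ext_deriv1 \<phi>) x $ m
      = inverse (inv_factor a x) * (- inv_factor a x * (\<Sum>i\<in>UNIV. partial i (?F i m) x))" for m
    using exhaust_2[of m] by (auto simp: codiff2_def G sum_2[where f = "\<lambda>j. g x $ _ $ j * _ j"] sum_2 vol_density_hyp_metric)
  have s: "(\<Sum>i\<in>UNIV. partial i (?F i m) x) = partial 1 (?F 1 m) x + partial 2 (?F 2 m) x" for m
    by (rule sum_2)
  show "codiff2 g (ext_deriv1 \<phi>) x $ 1 = partial 2 (\<lambda>y. inv_factor a y * curl \<phi> y) x"
    "codiff2 g (ext_deriv1 \<phi>) x $ 2 = - partial 1 (\<lambda>y. inv_factor a y * curl \<phi> y) x"
    unfolding cc s p0 p12 p21 using inv_factor_pos_U[OF assms(1)] by simp_all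
qed

lemma test_form_nth: "test_form U \<phi> \<Longrightarrow> test_function U (\<lambda>x. \<phi> x $ i)"
  by (simp add: test_form_def)

lemma test_function_smooth_mult:
  "smooth_on f U \<Longrightarrow> test_function U \<eta> \<Longrightarrow> test_function U (\<lambda>x. f x * \<eta> x)"
  by (rule test_function_mult[OF open_U])

lemma test_integrable: "test_function U \<eta> \<Longrightarrow> integrable (lebesgue_on U) \<eta>"
  using test_function_integrable_on[OF _ open_U] .

lemma weakly_coclosed_smooth:
  assumes u: "\<And>i. smooth_on (\<lambda>x. u x $ i) U" and div0: "\<And>x. x \<in> U \<Longrightarrow> divergence u x = 0"
  shows "weakly_coclosed g U u"
  unfolding weakly_coclosed_def
proof (intro allI impI)
  fix \<eta> assume \<eta>: "test_function U \<eta>"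
  have t: "test_function U (\<lambda>x. u x $ i * partial i \<eta> x)" for i
    by (rule test_function_smooth_mult[OF u test_function_partial[OF \<eta>]])
  have t': "test_function U (\<lambda>x. partial i (\<lambda>y. u y $ i) x * \<eta> x)" for i
    by (rule test_function_smooth_mult[OF smooth_on_partial[OF u] \<eta>])
  note I = test_integrable[OF t] and I' = test_integrable[OF t']
  have "(LINT x|vol g U. form_inner g x (u x) (ext_deriv0 \<eta> x))
      = (LINT x|lebesgue_on U. u x $ 1 * partial 1 \<eta> x + u x $ 2 * partial 2 \<eta> x)"
    by (rule vol_integral)
      (use Bochner_Integration.integrable_add[OF I I] in \<open>auto simp: form_inner_hyp_metric[OF a_pos norm_less_1]
        inner_vec_def sum_2 ext_deriv0_def\<close>)
  also have "\<dots> = (LINT x|lebesgue_on U. u x $ 1 * partial 1 \<eta> x) + (LINT x|lebesgue_on U. u x $ 2 * partial 2 \<eta> x)"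
    by (rule Bochner_Integration.integral_add[OF I I])
  also have "\<dots> = - (LINT x|lebesgue_on U. partial 1 (\<lambda>y. u y $ 1) x * \<eta> x + partial 2 (\<lambda>y. u y $ 2) x * \<eta> x)"
    unfolding integral_by_parts[OF open_U u \<eta>] Bochner_Integration.integral_add[OF I' I'] by simp
  also have "(LINT x|lebesgue_on U. partial 1 (\<lambda>y. u y $ 1) x * \<eta> x + partial 2 (\<lambda>y. u y $ 2) x * \<eta> x)
      = (LINT x|lebesgue_on U. 0)"
    by (rule Bochner_Integration.integral_cong) (use div0 in \<open>auto simp flip: distrib_right\<close>)
  finally show "(LINT x|vol g U. form_inner g x (u x) (ext_deriv0 \<eta> x)) = 0" by simp
qed

text \<open>All derivatives are moved from the test form \<open>\<phi>\<close> to \<open>u\<close> and \<open>p\<close>. The gradient part of the Hodge Laplacian drops out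
because \<open>u\<close> is divergence free. In the other part the first integration by parts produces the scalar vorticity \<open>W\<close>
(the curl, divided by the volume density), and the second one its derivatives.\<close>

lemma stokes_momentum_smooth:
  assumes u: "\<And>i. smooth_on (\<lambda>x. u x $ i) U" and p: "smooth_on p U" and W: "smooth_on W U"
    and div0: "\<And>x. x \<in> U \<Longrightarrow> divergence u x = 0"
    and curl: "\<And>x. x \<in> U \<Longrightarrow> inv_factor a x * curl u x = W x"
    and mom1: "\<And>x. x \<in> U \<Longrightarrow> partial 2 W x + 2 * a\<^sup>2 * u x $ 1 + partial 1 p x = 0"
    and mom2: "\<And>x. x \<in> U \<Longrightarrow> - partial 1 W x + 2 * a\<^sup>2 * u x $ 2 + partial 2 p x = 0"
  shows "stokes_momentum a g U u p"
  unfolding stokes_momentum_def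
proof (intro allI impI)
  fix \<phi> assume "test_form U \<phi>"
  note \<phi> = test_form_nth[OF this]
  let ?J = "\<lambda>f. (LINT x|lebesgue_on U. f x)"
  let ?q = "\<lambda>x. inv_factor a x * divergence \<phi> x" and ?r = "\<lambda>x. inv_factor a x * curl \<phi> x"
  have cs: "smooth_on (inv_factor a) U" by (rule smooth_on_subset[OF smooth_inv_factor]) simp
  have q: "test_function U ?q"
    by (intro test_function_smooth_mult[OF cs] test_function_add test_function_partial \<phi>)
  have r: "test_function U ?r"
    by (intro test_function_smooth_mult[OF cs] test_function_diff test_function_partial \<phi>)
  have diff: "\<eta> differentiable (at x)" if "test_function U \<eta>" for \<eta> x
    using that by (auto simp: test_function_def intro: smooth_on_imp_differentiable)
  have hodge: "neg_hodge_laplacian g \<phi> x $ 1 = - partial 1 ?q x + partial 2 ?r x"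
    "neg_hodge_laplacian g \<phi> x $ 2 = - partial 2 ?q x - partial 1 ?r x" if x: "x \<in> U" for x
  proof -
    have "partial i (codiff1 g \<phi>) x = partial i (\<lambda>y. (- 1) * ?q y) x" for i
      by (rule partial_cong_open[OF open_U x]) (simp add: codiff1_hyp_metric)
    then have "partial i (codiff1 g \<phi>) x = - partial i ?q x" for i
      unfolding partial_cmult[OF diff[OF q]] by simp
    then show "neg_hodge_laplacian g \<phi> x $ 1 = - partial 1 ?q x + partial 2 ?r x"
      "neg_hodge_laplacian g \<phi> x $ 2 = - partial 2 ?q x - partial 1 ?r x"
      by (simp_all add: neg_hodge_laplacian_def ext_deriv0_def codiff2_hyp_metric[OF x diff[OF r]])
  qed
  \<comment> \<open>every integrand below is a smooth function times a test function\<close>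
  have I: "integrable (lebesgue_on U) (\<lambda>x. f x * \<eta> x)" if "smooth_on f U" "test_function U \<eta>" for f \<eta>
    by (rule test_integrable[OF test_function_smooth_mult[OF that]])
  note up = I[OF u test_function_partial[OF q]] I[OF u test_function_partial[OF r]]
    and pu = I[OF smooth_on_partial[OF u] q] I[OF smooth_on_partial[OF u] r]
    and Wp = I[OF W test_function_partial[OF \<phi>]] and pW = I[OF smooth_on_partial[OF W] \<phi>]
    and pp = I[OF p test_function_partial[OF \<phi>]] and dp = I[OF smooth_on_partial[OF p] \<phi>]
    and u\<phi> = I[OF u \<phi>]
  note ibp = integral_by_parts[OF open_U]
  have A: "(LINT x|vol g U. form_inner g x (u x) (neg_hodge_laplacian g \<phi> x))
      = ?J (\<lambda>x. partial 2 W x * \<phi> x $ 1) - ?J (\<lambda>x. partial 1 W x * \<phi> x $ 2)"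
  proof -
    have "(LINT x|vol g U. form_inner g x (u x) (neg_hodge_laplacian g \<phi> x))
        = ?J (\<lambda>x. (u x $ 1 * partial 2 ?r x - u x $ 1 * partial 1 ?q x)
            - (u x $ 2 * partial 2 ?q x + u x $ 2 * partial 1 ?r x))"
    proof (rule vol_integral)
      show "(\<lambda>x. (u x $ 1 * partial 2 ?r x - u x $ 1 * partial 1 ?q x)
            - (u x $ 2 * partial 2 ?q x + u x $ 2 * partial 1 ?r x)) \<in> borel_measurable (lebesgue_on U)"
        by (intro borel_measurable_diff borel_measurable_add borel_measurable_integrable up)
    qed (simp add: form_inner_hyp_metric[OF a_pos norm_less_1] inner_vec_def sum_2 hodge algebra_simps)
    also have "\<dots> = (?J (\<lambda>x. u x $ 1 * partial 2 ?r x) - ?J (\<lambda>x. u x $ 1 * partial 1 ?q x))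
        - (?J (\<lambda>x. u x $ 2 * partial 2 ?q x) + ?J (\<lambda>x. u x $ 2 * partial 1 ?r x))"
      by (simp add: up Bochner_Integration.integral_diff Bochner_Integration.integral_add
          Bochner_Integration.integrable_diff Bochner_Integration.integrable_add)
    also have "\<dots> = (?J (\<lambda>x. partial 1 (\<lambda>y. u y $ 1) x * ?q x) + ?J (\<lambda>x. partial 2 (\<lambda>y. u y $ 2) x * ?q x))
        + (?J (\<lambda>x. partial 1 (\<lambda>y. u y $ 2) x * ?r x) - ?J (\<lambda>x. partial 2 (\<lambda>y. u y $ 1) x * ?r x))"
      unfolding ibp[OF u q] ibp[OF u r] by simp
    also have "\<dots> = ?J (\<lambda>x. partial 1 (\<lambda>y. u y $ 1) x * ?q x + partial 2 (\<lambda>y. u y $ 2) x * ?q x)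
        + ?J (\<lambda>x. partial 1 (\<lambda>y. u y $ 2) x * ?r x - partial 2 (\<lambda>y. u y $ 1) x * ?r x)"
      unfolding Bochner_Integration.integral_diff[OF pu(2) pu(2)] Bochner_Integration.integral_add[OF pu(1) pu(1)] ..
    also have "?J (\<lambda>x. partial 1 (\<lambda>y. u y $ 1) x * ?q x + partial 2 (\<lambda>y. u y $ 2) x * ?q x) = ?J (\<lambda>x. 0)"
      by (rule Bochner_Integration.integral_cong) (use div0 in \<open>auto simp flip: distrib_right\<close>)
    also have "?J (\<lambda>x. partial 1 (\<lambda>y. u y $ 2) x * ?r x - partial 2 (\<lambda>y. u y $ 1) x * ?r x)
        = ?J (\<lambda>x. W x * partial 1 (\<lambda>y. \<phi> y $ 2) x - W x * partial 2 (\<lambda>y. \<phi> y $ 1) x)"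
      by (rule Bochner_Integration.integral_cong) (auto simp: curl[symmetric] algebra_simps)
    also have "\<dots> = ?J (\<lambda>x. partial 2 W x * \<phi> x $ 1) - ?J (\<lambda>x. partial 1 W x * \<phi> x $ 2)"
      unfolding Bochner_Integration.integral_diff[OF Wp Wp] ibp[OF W \<phi>] by simp
    finally show ?thesis by simp
  qed
  have B: "(LINT x|vol g U. form_inner g x (u x) (\<phi> x))
      = ?J (\<lambda>x. u x $ 1 * \<phi> x $ 1) + ?J (\<lambda>x. u x $ 2 * \<phi> x $ 2)"
  proof -
    have "(LINT x|vol g U. form_inner g x (u x) (\<phi> x)) = ?J (\<lambda>x. u x $ 1 * \<phi> x $ 1 + u x $ 2 * \<phi> x $ 2)"
    proof (rule vol_integral)
      show "(\<lambda>x. u x $ 1 * \<phi> x $ 1 + u x $ 2 * \<phi> x $ 2) \<in> borel_measurable (lebesgue_on U)"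
        by (intro borel_measurable_add borel_measurable_integrable u\<phi>)
    qed (simp add: form_inner_hyp_metric[OF a_pos norm_less_1] inner_vec_def sum_2)
    then show ?thesis by (simp add: Bochner_Integration.integral_add[OF u\<phi> u\<phi>])
  qed
  have C: "(LINT x|vol g U. p x * codiff1 g \<phi> x)
      = ?J (\<lambda>x. partial 1 p x * \<phi> x $ 1) + ?J (\<lambda>x. partial 2 p x * \<phi> x $ 2)"
  proof -
    have "(LINT x|vol g U. p x * codiff1 g \<phi> x)
        = ?J (\<lambda>x. - (p x * partial 1 (\<lambda>y. \<phi> y $ 1) x + p x * partial 2 (\<lambda>y. \<phi> y $ 2) x))"
    proof (rule vol_integral)
      show "(\<lambda>x. - (p x * partial 1 (\<lambda>y. \<phi> y $ 1) x + p x * partial 2 (\<lambda>y. \<phi> y $ 2) x))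
          \<in> borel_measurable (lebesgue_on U)"
        by (intro borel_measurable_uminus borel_measurable_add borel_measurable_integrable pp)
    qed (simp add: codiff1_hyp_metric algebra_simps)
    also have "\<dots> = - (?J (\<lambda>x. p x * partial 1 (\<lambda>y. \<phi> y $ 1) x) + ?J (\<lambda>x. p x * partial 2 (\<lambda>y. \<phi> y $ 2) x))"
      unfolding Bochner_Integration.integral_minus Bochner_Integration.integral_add[OF pp pp] ..
    finally show ?thesis unfolding ibp[OF p \<phi>] by simp
  qed
  have "(LINT x|vol g U. form_inner g x (u x) (neg_hodge_laplacian g \<phi> x))
      + 2 * a\<^sup>2 * (LINT x|vol g U. form_inner g x (u x) (\<phi> x)) + (LINT x|vol g U. p x * codiff1 g \<phi> x)
      = (?J (\<lambda>x. partial 2 W x * \<phi> x $ 1) + 2 * a\<^sup>2 * ?J (\<lambda>x. u x $ 1 * \<phi> x $ 1) + ?J (\<lambda>x. partial 1 p x * \<phi> x $ 1))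
      + (- ?J (\<lambda>x. partial 1 W x * \<phi> x $ 2) + 2 * a\<^sup>2 * ?J (\<lambda>x. u x $ 2 * \<phi> x $ 2) + ?J (\<lambda>x. partial 2 p x * \<phi> x $ 2))"
    unfolding A B C by (simp add: algebra_simps)
  also have "?J (\<lambda>x. partial 2 W x * \<phi> x $ 1) + 2 * a\<^sup>2 * ?J (\<lambda>x. u x $ 1 * \<phi> x $ 1) + ?J (\<lambda>x. partial 1 p x * \<phi> x $ 1)
      = ?J (\<lambda>x. partial 2 W x * \<phi> x $ 1 + 2 * a\<^sup>2 * (u x $ 1 * \<phi> x $ 1) + partial 1 p x * \<phi> x $ 1)"
    by (simp add: pW dp u\<phi>)
  also have "\<dots> = ?J (\<lambda>x. 0)"
  proof (rule Bochner_Integration.integral_cong)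
    fix x assume "x \<in> space (lebesgue_on U)"
    then have "(partial 2 W x + 2 * a\<^sup>2 * u x $ 1 + partial 1 p x) * \<phi> x $ 1 = 0" using mom1 by simp
    then show "partial 2 W x * \<phi> x $ 1 + 2 * a\<^sup>2 * (u x $ 1 * \<phi> x $ 1) + partial 1 p x * \<phi> x $ 1 = 0"
      by (simp add: algebra_simps)
  qed simp
  also have "- ?J (\<lambda>x. partial 1 W x * \<phi> x $ 2) + 2 * a\<^sup>2 * ?J (\<lambda>x. u x $ 2 * \<phi> x $ 2) + ?J (\<lambda>x. partial 2 p x * \<phi> x $ 2)
      = ?J (\<lambda>x. - (partial 1 W x * \<phi> x $ 2) + 2 * a\<^sup>2 * (u x $ 2 * \<phi> x $ 2) + partial 2 p x * \<phi> x $ 2)"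
    by (simp add: pW dp u\<phi>)
  also have "\<dots> = ?J (\<lambda>x. 0)"
  proof (rule Bochner_Integration.integral_cong)
    fix x assume "x \<in> space (lebesgue_on U)"
    then have "(- partial 1 W x + 2 * a\<^sup>2 * u x $ 2 + partial 2 p x) * \<phi> x $ 2 = 0" using mom2 by simp
    then show "- (partial 1 W x * \<phi> x $ 2) + 2 * a\<^sup>2 * (u x $ 2 * \<phi> x $ 2) + partial 2 p x * \<phi> x $ 2 = 0"
      by (simp add: algebra_simps)
  qed simp
  finally show "(LINT x|vol g U. form_inner g x (u x) (neg_hodge_laplacian g \<phi> x))
      + 2 * a\<^sup>2 * (LINT x|vol g U. form_inner g x (u x) (\<phi> x)) + (LINT x|vol g U. p x * codiff1 g \<phi> x) = 0"
    by simp
qed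

lemma L2_loc_continuous:
  assumes p: "continuous_on U p"
  shows "L2_loc g U p"
  unfolding L2_loc_def set_integrable_def
proof (intro conjI allI impI measurable_continuous[OF p])
  fix K assume K: "compact K \<and> K \<subseteq> U"
  have c: "continuous_on U (\<lambda>x. (p x)\<^sup>2 / inv_factor a x)"
    using inv_factor_pos_U by (intro continuous_intros continuous_inv_factor p) force
  have i: "integrable lebesgue (\<lambda>x. indicator K x *\<^sub>R ((p x)\<^sup>2 / inv_factor a x))"
    using L1_loc_continuous[OF c] K unfolding L1_loc_def set_integrable_def by blast
  have e: "(\<lambda>x. indicator U x *\<^sub>R (indicator K x *\<^sub>R ((p x)\<^sup>2 / inv_factor a x)))
      = (\<lambda>x. indicator K x *\<^sub>R ((p x)\<^sup>2 / inv_factor a x))"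
    using K by (auto simp: fun_eq_iff indicator_def)
  have "integrable (lebesgue_on U) (\<lambda>x. indicator K x *\<^sub>R ((p x)\<^sup>2 / inv_factor a x))"
    using i U_sets e integrable_restrict_space[of U lebesgue "\<lambda>x. indicator K x *\<^sub>R ((p x)\<^sup>2 / inv_factor a x)"]
    by simp
  then show "integrable (vol g U) (\<lambda>x. indicator K x *\<^sub>R (p x)\<^sup>2)"
    by (subst vol_integrable[where h = "\<lambda>x. indicator K x *\<^sub>R ((p x)\<^sup>2 / inv_factor a x)"])
      (auto dest: inv_factor_pos_U intro: borel_measurable_integrable)
qed

end

section \<open>Covariant derivatives and the space of forms vanishing at the boundary\<close>

context hyp_domain
begin

lemma bounded_continuous_integrable:
  fixes f :: "real^2 \<Rightarrow> real"
  assumes "continuous_on U f" "\<And>x. x \<in> U \<Longrightarrow> \<bar>f x\<bar> \<le> C"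
  shows "integrable (lebesgue_on U) f"
  using assms measurable_continuous
  by (intro finite_measure.integrable_const_bound[OF finite_measure_U, where B = C]) auto

lemma bounded_convergence:
  fixes f :: "nat \<Rightarrow> real^2 \<Rightarrow> real"
  assumes "\<And>n. continuous_on U (f n)" "\<And>n x. x \<in> U \<Longrightarrow> \<bar>f n x\<bar> \<le> C"
    and "\<And>x. x \<in> U \<Longrightarrow> (\<lambda>n. f n x) \<longlonglongrightarrow> 0"
  shows "(\<lambda>n. LINT x|lebesgue_on U. f n x) \<longlonglongrightarrow> 0"
proof -
  have "(\<lambda>n. LINT x|lebesgue_on U. f n x) \<longlonglongrightarrow> (LINT x|lebesgue_on U. 0)"
  proof (rule integral_dominated_convergence[where w = "\<lambda>_. C"])
    show "integrable (lebesgue_on U) (\<lambda>_. C)"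
      by (rule finite_measure.integrable_const[OF finite_measure_U])
    show "f n \<in> borel_measurable (lebesgue_on U)" for n by (rule measurable_continuous[OF assms(1)])
  qed (use assms(2,3) in auto)
  then show ?thesis by simp
qed

lemma partial_norm_sq: "partial i (\<lambda>x::real^2. (norm x)\<^sup>2) x = 2 * x $ i"
proof -
  have "((\<lambda>x. x \<bullet> x) has_derivative (\<lambda>v. x \<bullet> v + v \<bullet> x)) (at x)"
    by (rule has_derivative_inner) (auto intro: has_derivative_ident)
  from partial_eq[OF this] show ?thesis
    by (simp add: power2_norm_eq_inner inner_axis inner_axis' )
qed

lemma partial_inv_factor: "partial i (inv_factor a) x = - (a\<^sup>2 * (1 - (norm x)\<^sup>2) * x $ i)"
proof -
  have d: "(\<lambda>x. (norm x)\<^sup>2) differentiable (at x)"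
    using smooth_on_imp_differentiable[OF smooth_norm_sq[of UNIV]] by simp
  have "((\<lambda>t. a\<^sup>2 * (1 - t)\<^sup>2 / 4) has_real_derivative - (a\<^sup>2 * (1 - (norm x)\<^sup>2) / 2)) (at ((norm x)\<^sup>2))"
    by (auto intro!: derivative_eq_intros simp: field_simps)
  from partial_comp[OF d this, of i]
  have "partial i (inv_factor a) x = - (a\<^sup>2 * (1 - (norm x)\<^sup>2) / 2) * (2 * x $ i)"
    unfolding inv_factor_def[abs_def] partial_norm_sq .
  then show ?thesis by simp
qed

lemma christoffel_hyp_metric:
  assumes x: "x \<in> U"
  shows "christoffel g k i j x = 2 / (1 - (norm x)\<^sup>2) *
    ((if k = j then x $ i else 0) + (if k = i then x $ j else 0) - (if i = j then x $ k else 0))"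
proof -
  let ?s = "1 - (norm x)\<^sup>2"
  have s: "?s > 0" by (rule one_minus_norm_sq_pos[OF x])
  have dg: "partial i (\<lambda>y. g y $ j $ l) x = (if j = l then 4 * x $ i / (?s * inv_factor a x) else 0)" for i j l
  proof (cases "j = l")
    case True
    have d: "inv_factor a differentiable (at x)" by (rule smooth_on_imp_differentiable[OF smooth_inv_factor UNIV_I])
    have "partial i (\<lambda>y. inverse (inv_factor a y)) x = a\<^sup>2 * ?s * x $ i / (inv_factor a x)\<^sup>2"
      using partial_inverse[OF d, of i] inv_factor_pos_U[OF x] by (simp add: partial_inv_factor field_simps power2_eq_square)
    also have "\<dots> = 4 * x $ i / (?s * inv_factor a x)"
    proof -
      have c: "a\<^sup>2 * ?s\<^sup>2 = 4 * inv_factor a x" by (simp add: inv_factor_def)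
      have "a\<^sup>2 * ?s * x $ i * (?s * inv_factor a x) = (a\<^sup>2 * ?s\<^sup>2) * x $ i * inv_factor a x"
        by (simp only: power2_eq_square mult_ac)
      also have "\<dots> = 4 * x $ i * (inv_factor a x)\<^sup>2" unfolding c by (simp add: power2_eq_square)
      finally show ?thesis using s inv_factor_pos_U[OF x] by (simp add: frac_eq_eq)
    qed
    finally show ?thesis using True by (simp add: hyp_metric_inv_factor mat_def)
  qed (simp add: hyp_metric_inv_factor mat_def)
  have "christoffel g k i j x = (1/2) * (inv_factor a x * (partial i (\<lambda>y. g y $ j $ k) x
      + partial j (\<lambda>y. g y $ i $ k) x - partial k (\<lambda>y. g y $ i $ j) x))"
    using exhaust_2[of k] by (auto simp: christoffel_def sum_2 ginv_hyp_metric[OF a_pos norm_less_1[OF x]])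
  also have "inv_factor a x * (partial i (\<lambda>y. g y $ j $ k) x
      + partial j (\<lambda>y. g y $ i $ k) x - partial k (\<lambda>y. g y $ i $ j) x)
      = 4 / ?s * ((if k = j then x $ i else 0) + (if k = i then x $ j else 0) - (if i = j then x $ k else 0))"
  proof -
    have c: "inv_factor a x * (4 * y / (?s * inv_factor a x)) = 4 / ?s * y" for y
      using inv_factor_pos_U[OF x] by simp
    have if0: "inv_factor a x * (if Q then 4 * y / (?s * inv_factor a x) else 0) = 4 / ?s * (if Q then y else 0)" for Q y
      using c by simp
    show ?thesis unfolding dg distrib_left right_diff_distrib if0 by (simp add: eq_commute)
  qed
  finally have eq: "christoffel g k i j x = (1/2) * (4 / ?s *
    ((if k = j then x $ i else 0) + (if k = i then x $ j else 0) - (if i = j then x $ k else 0)))" .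
  have half: "(1/2) * (4 / r * y) = 2 / r * y" for r y :: real by simp
  show ?thesis unfolding eq half ..
qed

text \<open>The Christoffel symbols are of size \<open>1 / (1 - \<bar>x\<bar>\<^sup>2)\<close> at the circle at infinity. Multiplying the covariant
derivative by \<open>1 - \<bar>x\<bar>\<^sup>2\<close> removes that singularity, and up to a constant the metric and the volume density put exactly
this weight on its Euclidean norm. So every form that is bounded with its first derivatives in the coordinates
has finite Dirichlet energy.\<close>

definition scaled_cov_deriv :: "(real^2 \<Rightarrow> real^2) \<Rightarrow> 2 \<Rightarrow> 2 \<Rightarrow> real^2 \<Rightarrow> real" where
  "scaled_cov_deriv u i j x = (1 - (norm x)\<^sup>2) * partial i (\<lambda>y. u y $ j) x - 2 *
    (\<Sum>k\<in>UNIV. ((if k = j then x $ i else 0) + (if k = i then x $ j else 0) - (if i = j then x $ k else 0)) * u x $ k)"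

lemma cov_deriv_hyp_metric:
  assumes x: "x \<in> U"
  shows "cov_deriv g u x $ i $ j = scaled_cov_deriv u i j x / (1 - (norm x)\<^sup>2)"
proof -
  define c where "c k = (if k = j then x $ i else 0) + (if k = i then x $ j else 0) - (if i = j then x $ k else 0)" for k
  define t where "t = 1 - (norm x)\<^sup>2"
  have "t > 0" using one_minus_norm_sq_pos[OF x] by (simp add: t_def)
  have chr: "christoffel g k i j x = 2 / t * c k" for k
    unfolding christoffel_hyp_metric[OF x] c_def t_def ..
  have scal: "scaled_cov_deriv u i j x = t * partial i (\<lambda>y. u y $ j) x - 2 * (\<Sum>k\<in>UNIV. c k * u x $ k)"
    unfolding scaled_cov_deriv_def c_def t_def ..
  show ?thesis
    unfolding t_def[symmetric] scal using \<open>t > 0\<close>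
    by (simp add: cov_deriv_def chr sum_2) (simp add: field_simps)
qed

lemma tensor_inner_scaled:
  assumes x: "x \<in> U" and A: "\<And>i j. A $ i $ j = T i j / (1 - (norm x)\<^sup>2)"
  shows "tensor_inner g x A A = inv_factor a x * (a\<^sup>2 / 4 * (\<Sum>i\<in>UNIV. \<Sum>j\<in>UNIV. (T i j)\<^sup>2))"
proof -
  let ?s = "1 - (norm x)\<^sup>2" and ?S = "\<Sum>i\<in>UNIV. \<Sum>j\<in>UNIV. (T i j)\<^sup>2"
  have "(\<Sum>i\<in>UNIV. \<Sum>j\<in>UNIV. (A $ i $ j)\<^sup>2) = ?S / ?s\<^sup>2"
    by (simp only: A power_divide sum_divide_distrib)
  then have "tensor_inner g x A A = inv_factor a x * (inv_factor a x / ?s\<^sup>2 * ?S)"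
    unfolding tensor_inner_hyp_metric[OF a_pos norm_less_1[OF x]] by (simp add: power2_eq_square[of "inv_factor a x"])
  also have "inv_factor a x / ?s\<^sup>2 = a\<^sup>2 / 4" using one_minus_norm_sq_pos[OF x] by (simp add: inv_factor_def)
  finally show ?thesis .
qed

lemma weak_cov_deriv_smooth:
  assumes u: "\<And>i. smooth_on (\<lambda>x. u x $ i) U"
  shows "weak_cov_deriv g U u (cov_deriv g u)"
  unfolding weak_cov_deriv_def
proof (intro allI)
  fix i j
  have "(\<lambda>x. cov_deriv g u x $ i $ j + (\<Sum>k\<in>UNIV. christoffel g k i j x * u x $ k)) = partial i (\<lambda>x. u x $ j)"
    by (simp add: cov_deriv_def)
  then show "weak_partial U i (\<lambda>x. u x $ j)
      (\<lambda>x. cov_deriv g u x $ i $ j + (\<Sum>k\<in>UNIV. christoffel g k i j x * u x $ k))"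
    using weak_partial_smooth[OF open_U u] by simp
qed

lemma continuous_scaled_cov_deriv:
  assumes u: "\<And>i. smooth_on (\<lambda>x. u x $ i) U"
  shows "continuous_on U (scaled_cov_deriv u i j)"
proof -
  have c: "continuous_on U (\<lambda>x. u x $ i)" "continuous_on U (partial i (\<lambda>x. u x $ j))" for i j
    using u smooth_on_partial smooth_on_imp_continuous_on by blast+
  have x: "continuous_on U (\<lambda>x::real^2. if P then x $ i else 0)" for P i
    by (cases P) (auto intro: continuous_intros)
  show ?thesis unfolding scaled_cov_deriv_def[abs_def]
    by (intro continuous_intros c x)
qed

lemma continuous_cov_deriv:
  assumes u: "\<And>i. smooth_on (\<lambda>x. u x $ i) U"
  shows "continuous_on U (cov_deriv g u)"
proof -
  have "continuous_on U (\<lambda>x. \<chi> i j. scaled_cov_deriv u i j x / (1 - (norm x)\<^sup>2))"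
    using one_minus_norm_sq_pos
    by (intro continuous_intros continuous_scaled_cov_deriv u) force
  then show ?thesis
    by (rule continuous_on_eq) (simp add: vec_eq_iff cov_deriv_hyp_metric)
qed

lemma sum_sq_le:
  fixes T :: "2 \<Rightarrow> 2 \<Rightarrow> real"
  assumes "\<And>i j. \<bar>T i j\<bar> \<le> C"
  shows "(\<Sum>i\<in>UNIV. \<Sum>j\<in>UNIV. (T i j)\<^sup>2) \<le> 4 * C\<^sup>2"
proof -
  have "(T i j)\<^sup>2 \<le> C\<^sup>2" for i j
    using power_mono[OF assms[of i j], of 2] by simp
  then have "(\<Sum>i\<in>UNIV. \<Sum>j\<in>UNIV. (T i j)\<^sup>2) \<le> (\<Sum>i\<in>(UNIV::2 set). \<Sum>j\<in>(UNIV::2 set). C\<^sup>2)"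
    by (intro sum_mono)
  then show ?thesis by simp
qed

lemma L2_form_bounded:
  assumes u: "\<And>i. continuous_on U (\<lambda>x. u x $ i)" and B: "\<And>x i. x \<in> U \<Longrightarrow> \<bar>u x $ i\<bar> \<le> B"
  shows "L2_form g U u"
  unfolding L2_form_def
proof
  have cu: "continuous_on U u"
    using continuous_on_vec_lambda[of U "\<lambda>i x. u x $ i"] u by simp
  then show "u \<in> borel_measurable (lebesgue_on U)" by (rule measurable_continuous)
  have "integrable (lebesgue_on U) (\<lambda>x. u x \<bullet> u x)"
  proof (rule bounded_continuous_integrable)
    show "\<bar>u x \<bullet> u x\<bar> \<le> 2 * B\<^sup>2" if "x \<in> U" for x
      using power_mono[OF B[OF that, of 1], of 2] power_mono[OF B[OF that, of 2], of 2]
      by (simp add: inner_vec_def sum_2 power2_eq_square)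
  qed (intro continuous_intros cu)
  then show "integrable (vol g U) (\<lambda>x. form_inner g x (u x) (u x))"
    by (subst vol_integrable[where h = "\<lambda>x. u x \<bullet> u x"])
      (auto simp: form_inner_hyp_metric[OF a_pos norm_less_1])
qed

lemma L2_tensor_cov_deriv:
  assumes u: "\<And>i. smooth_on (\<lambda>x. u x $ i) U"
    and B: "\<And>x i j. x \<in> U \<Longrightarrow> \<bar>scaled_cov_deriv u i j x\<bar> \<le> B"
  shows "L2_tensor g U (cov_deriv g u)"
  unfolding L2_tensor_def
proof
  show "cov_deriv g u \<in> borel_measurable (lebesgue_on U)"
    by (rule measurable_continuous[OF continuous_cov_deriv[OF u]])
  let ?h = "\<lambda>x. a\<^sup>2 / 4 * (\<Sum>i\<in>UNIV. \<Sum>j\<in>UNIV. (scaled_cov_deriv u i j x)\<^sup>2)"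
  have "integrable (lebesgue_on U) ?h"
  proof (rule bounded_continuous_integrable)
    show "continuous_on U ?h" by (intro continuous_intros continuous_scaled_cov_deriv u)
    show "\<bar>?h x\<bar> \<le> a\<^sup>2 / 4 * (4 * B\<^sup>2)" if "x \<in> U" for x
    proof -
      have "?h x \<le> a\<^sup>2 / 4 * (4 * B\<^sup>2)" by (intro mult_left_mono sum_sq_le B that) simp
      moreover have "0 \<le> ?h x" by (intro mult_nonneg_nonneg sum_nonneg) auto
      ultimately show ?thesis by simp
    qed
  qed
  then show "integrable (vol g U) (\<lambda>x. tensor_inner g x (cov_deriv g u x) (cov_deriv g u x))"
    by (subst vol_integrable[where h = ?h])
      (auto intro: borel_measurable_integrable simp: tensor_inner_scaled[OF _ cov_deriv_hyp_metric])
qed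

end

text \<open>The purpose of \<open>s\<close> is to supply cutoffs. The functions \<open>e\<^sub>0(n s - 1)\<close> vanish where
\<open>s \<le> 1/n\<close>. They converge to 1 on the whole domain without being equal to 1 anywhere, which is enough for
dominated convergence.\<close>

locale hyp_domain_boundary = hyp_domain +
  fixes s :: "real^2 \<Rightarrow> real"
  assumes s_smooth: "smooth_on s UNIV" and s_pos_iff: "\<And>x. s x > 0 \<longleftrightarrow> x \<in> U"
begin

definition cutoff :: "nat \<Rightarrow> real^2 \<Rightarrow> real" where
  "cutoff n x = exp_cutoff 0 (real n * s x - 1)"

lemma partial_s_bounded: "\<exists>C\<ge>0. \<forall>x\<in>U. \<forall>i. \<bar>partial i s x\<bar> \<le> C"
proof -
  have "bounded (partial i s ` cball 0 1)" for i
    using smooth_on_imp_continuous_on[OF smooth_on_partial[OF s_smooth]]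
    by (intro compact_imp_bounded compact_continuous_image) (auto intro: continuous_on_subset)
  then obtain C where C: "\<And>i x. x \<in> cball 0 1 \<Longrightarrow> \<bar>partial i s x\<bar> \<le> C i"
    unfolding bounded_iff by (metis imageI real_norm_def)
  have "\<bar>partial i s x\<bar> \<le> \<bar>C 1\<bar> + \<bar>C 2\<bar>" if "x \<in> U" for i x
    using C[of x i] norm_less_1[OF that] exhaust_2[of i] by auto
  then show ?thesis by (intro exI[of _ "\<bar>C 1\<bar> + \<bar>C 2\<bar>"]) auto
qed

lemma smooth_cutoff: "smooth_on (cutoff n) UNIV"
  unfolding cutoff_def[abs_def]
  by (intro smooth_on_exp_cutoff smooth_on_intros s_smooth open_UNIV)

lemma test_function_cutoff: "test_function U (cutoff n)"
proof (rule test_functionI[OF smooth_cutoff])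
  let ?K = "{x. 1 \<le> real n * s x}"
  have "continuous_on UNIV s" by (rule smooth_on_imp_continuous_on[OF s_smooth])
  then have "closed ?K" by (intro closed_Collect_le continuous_intros)
  moreover show KU: "?K \<subseteq> U"
  proof
    fix x assume "x \<in> ?K"
    then have "0 < real n * s x" by auto
    then show "x \<in> U" using s_pos_iff by (simp add: zero_less_mult_iff)
  qed
  then have "?K \<subseteq> ball 0 1" using norm_less_1 by (simp add: subset_iff)
  then have "bounded ?K" by (rule bounded_subset[OF bounded_ball])
  ultimately show "compact ?K" by (simp add: compact_eq_bounded_closed)
  show "cutoff n x = 0" if "x \<notin> ?K" for x using that by (simp add: cutoff_def exp_cutoff_def)
qed

lemma partial_cutoff:
  "partial i (cutoff n) x = exp_cutoff 2 (real n * s x - 1) * (real n * partial i s x)"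
proof -
  have ds: "s differentiable (at x)" by (rule smooth_on_imp_differentiable[OF s_smooth UNIV_I])
  have "((\<lambda>t. exp_cutoff 0 (real n * t - 1)) has_real_derivative
      exp_cutoff 2 (real n * s x - 1) * real n) (at (s x))"
  proof -
    have "((\<lambda>t. real n * t - 1) has_real_derivative real n) (at (s x))"
      by (auto intro!: derivative_eq_intros)
    from DERIV_chain2[where f = "exp_cutoff 0", OF exp_cutoff_deriv this] show ?thesis
      by (simp add: numeral_2_eq_2)
  qed
  from partial_comp[OF ds this] show ?thesis unfolding cutoff_def[abs_def] by simp
qed

lemma argument_at_top: "x \<in> U \<Longrightarrow> filterlim (\<lambda>n. real n * s x - 1) at_top sequentially"
proof -
  assume "x \<in> U"
  then have "s x > 0" using s_pos_iff by simp
  then have "filterlim (\<lambda>n. s x * real n) at_top sequentially"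
    by (intro filterlim_tendsto_pos_mult_at_top[OF tendsto_const] filterlim_real_sequentially)
  then show ?thesis
    using filterlim_tendsto_add_at_top[OF tendsto_const, of _ sequentially "-1"]
    by (fastforce simp: mult.commute)
qed

lemma cutoff_tendsto_1: "x \<in> U \<Longrightarrow> (\<lambda>n. cutoff n x) \<longlonglongrightarrow> 1"
  unfolding cutoff_def using filterlim_compose[OF exp_cutoff_0_tendsto_1 argument_at_top] .

lemma s_times_partial_cutoff:
  "s x * partial i (cutoff n) x = (((real n * s x - 1) + 1) * exp_cutoff 2 (real n * s x - 1)) * partial i s x"
  by (simp add: partial_cutoff mult_ac)

text \<open>The gradient of the cutoff is of size \<open>n\<close> in the layer where \<open>s\<close> is of size \<open>1/n\<close>. Multiplied by \<open>s\<close> it is bounded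
uniformly in \<open>n\<close>, and it tends to zero at each point.\<close>

lemma s_times_partial_cutoff_bound: "\<bar>s x * partial i (cutoff n) x\<bar> \<le> 2 * \<bar>partial i s x\<bar>"
  unfolding s_times_partial_cutoff abs_mult[of _ "partial i s x"]
  using exp_cutoff_2_weighted_bounds[of "real n * s x - 1"] by (intro mult_right_mono) auto

lemma s_times_partial_cutoff_tendsto_0: "x \<in> U \<Longrightarrow> (\<lambda>n. s x * partial i (cutoff n) x) \<longlonglongrightarrow> 0"
  unfolding s_times_partial_cutoff
  using tendsto_mult_left_zero[OF filterlim_compose[OF exp_cutoff_2_weighted_tendsto_0 argument_at_top]] .

lemma scaled_cov_deriv_cutoff:
  assumes x: "x \<in> U" and u: "\<And>i. smooth_on (\<lambda>x. u x $ i) U"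
  shows "scaled_cov_deriv (\<lambda>x. cutoff n x *\<^sub>R u x) i j x
    = cutoff n x * scaled_cov_deriv u i j x + (1 - (norm x)\<^sup>2) * u x $ j * partial i (cutoff n) x"
proof -
  have "partial i (\<lambda>y. cutoff n y * u y $ j) x
      = cutoff n x * partial i (\<lambda>y. u y $ j) x + partial i (cutoff n) x * u x $ j"
    using smooth_on_imp_differentiable[OF smooth_cutoff UNIV_I] smooth_on_imp_differentiable[OF u x]
    by (rule partial_mult)
  then show ?thesis by (simp add: scaled_cov_deriv_def sum_2 algebra_simps)
qed

text \<open>The forms \<open>cutoff n *\<^sub>R u\<close> approximate \<open>u\<close>. The critical term in the difference of the covariant derivatives is the
gradient of the cutoff times \<open>u\<close>; the last hypothesis trades \<open>(1 - \<bar>x\<bar>\<^sup>2) \<bar>u\<bar>\<close> for \<open>s\<close>, and \<open>s\<close> times the gradient of the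
cutoff is controlled. This hypothesis is a boundary condition only at boundary points inside the disc: at the
circle at infinity \<open>1 - \<bar>x\<bar>\<^sup>2\<close> vanishes by itself.\<close>

lemma smooth_in_H1_0:
  assumes u: "\<And>i. smooth_on (\<lambda>x. u x $ i) U"
    and bu: "\<And>x i. x \<in> U \<Longrightarrow> \<bar>u x $ i\<bar> \<le> B"
    and bD: "\<And>x i j. x \<in> U \<Longrightarrow> \<bar>scaled_cov_deriv u i j x\<bar> \<le> B"
    and bs: "\<And>x i. x \<in> U \<Longrightarrow> \<bar>u x $ i\<bar> * (1 - (norm x)\<^sup>2) \<le> C * s x"
  shows "u \<in> H1_0 g U"
  unfolding H1_0_def mem_Collect_eq
proof (intro conjI exI[of _ "cov_deriv g u"] exI[of _ "\<lambda>n x. cutoff n x *\<^sub>R u x"] allI)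
  let ?\<phi> = "\<lambda>n x. cutoff n x *\<^sub>R u x"
  have cu: "continuous_on U (\<lambda>x. u x $ i)" for i by (rule smooth_on_imp_continuous_on[OF u])
  have cu': "continuous_on U u"
    using continuous_on_vec_lambda[of U "\<lambda>i x. u x $ i"] cu by simp
  have cc: "continuous_on U (cutoff n)" "continuous_on U (partial i (cutoff n))" for n i
    using smooth_on_imp_continuous_on[OF smooth_cutoff]
      smooth_on_imp_continuous_on[OF smooth_on_partial[OF smooth_cutoff]]
    by (blast intro: continuous_on_subset)+
  show "L2_form g U u" by (rule L2_form_bounded[OF cu bu])
  show "weak_cov_deriv g U u (cov_deriv g u)" by (rule weak_cov_deriv_smooth[OF u])
  show "L2_tensor g U (cov_deriv g u)" by (rule L2_tensor_cov_deriv[OF u bD])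
  show "test_form U (?\<phi> n)" for n
    unfolding test_form_def
    using test_function_smooth_mult[OF u test_function_cutoff] by (simp add: mult.commute)
  have c01: "0 \<le> cutoff n x" "cutoff n x \<le> 1" for n x by (simp_all add: cutoff_def exp_cutoff_0_bounds)
  obtain K where K: "K \<ge> 0" "\<And>x i. x \<in> U \<Longrightarrow> \<bar>partial i s x\<bar> \<le> K"
    using partial_s_bounded by blast
  have form: "(\<lambda>n. LINT x|vol g U. form_inner g x (?\<phi> n x - u x) (?\<phi> n x - u x)) \<longlonglongrightarrow> 0"
  proof -
    let ?h = "\<lambda>n x. (cutoff n x - 1)\<^sup>2 * (u x \<bullet> u x)"
    have ch: "continuous_on U (?h n)" for n by (intro continuous_intros cc cu')
    have "(LINT x|vol g U. form_inner g x (?\<phi> n x - u x) (?\<phi> n x - u x)) = (LINT x|lebesgue_on U. ?h n x)" for n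
    proof (rule vol_integral[OF _ measurable_continuous[OF ch]])
      fix x assume "x \<in> U"
      have "?\<phi> n x - u x = (cutoff n x - 1) *\<^sub>R u x" by (simp add: algebra_simps)
      then show "form_inner g x (?\<phi> n x - u x) (?\<phi> n x - u x) = inv_factor a x * ?h n x"
        using \<open>x \<in> U\<close> by (simp add: form_inner_hyp_metric[OF a_pos norm_less_1] power2_eq_square)
    qed
    moreover have "(\<lambda>n. LINT x|lebesgue_on U. ?h n x) \<longlonglongrightarrow> 0"
    proof (rule bounded_convergence[OF ch])
      fix x assume x: "x \<in> U"
      have "u x \<bullet> u x \<le> 2 * B\<^sup>2"
        using power_mono[OF bu[OF x, of 1], of 2] power_mono[OF bu[OF x, of 2], of 2]
        by (simp add: inner_vec_def sum_2 power2_eq_square)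
      moreover have "(cutoff n x - 1)\<^sup>2 \<le> 1" for n using c01[of n x] by (simp add: abs_square_le_1)
      ultimately have "?h n x \<le> 1 * (2 * B\<^sup>2)" for n by (intro mult_mono) auto
      then show "\<bar>?h n x\<bar> \<le> 2 * B\<^sup>2" for n by simp
      have "(\<lambda>n. ?h n x) \<longlonglongrightarrow> (1 - 1)\<^sup>2 * (u x \<bullet> u x)" by (intro tendsto_intros cutoff_tendsto_1 x)
      then show "(\<lambda>n. ?h n x) \<longlonglongrightarrow> 0" by simp
    qed
    ultimately show ?thesis by simp
  qed
  have tensor: "(\<lambda>n. LINT x|vol g U. tensor_inner g x (cov_deriv g (?\<phi> n) x - cov_deriv g u x)
      (cov_deriv g (?\<phi> n) x - cov_deriv g u x)) \<longlonglongrightarrow> 0"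
  proof -
    let ?T = "\<lambda>n x i j. (cutoff n x - 1) * scaled_cov_deriv u i j x + (1 - (norm x)\<^sup>2) * u x $ j * partial i (cutoff n) x"
    let ?h = "\<lambda>n x. a\<^sup>2 / 4 * (\<Sum>i\<in>UNIV. \<Sum>j\<in>UNIV. (?T n x i j)\<^sup>2)"
    have ch: "continuous_on U (?h n)" for n
      by (intro continuous_intros cc cu continuous_scaled_cov_deriv u)
    have "(LINT x|vol g U. tensor_inner g x (cov_deriv g (?\<phi> n) x - cov_deriv g u x)
      (cov_deriv g (?\<phi> n) x - cov_deriv g u x)) = (LINT x|lebesgue_on U. ?h n x)" for n
    proof (rule vol_integral[OF _ measurable_continuous[OF ch]])
      fix x assume x: "x \<in> U"
      show "tensor_inner g x (cov_deriv g (?\<phi> n) x - cov_deriv g u x)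
          (cov_deriv g (?\<phi> n) x - cov_deriv g u x) = inv_factor a x * ?h n x"
      proof (rule tensor_inner_scaled[OF x])
        show "(cov_deriv g (?\<phi> n) x - cov_deriv g u x) $ i $ j = ?T n x i j / (1 - (norm x)\<^sup>2)" for i j
          unfolding vector_minus_component cov_deriv_hyp_metric[OF x] scaled_cov_deriv_cutoff[OF x u]
          by (simp add: diff_divide_distrib[symmetric] algebra_simps)
      qed
    qed
    moreover have "(\<lambda>n. LINT x|lebesgue_on U. ?h n x) \<longlonglongrightarrow> 0"
    proof (rule bounded_convergence[OF ch])
      fix x assume x: "x \<in> U"
      have sx: "s x > 0" using x s_pos_iff by simp
      have n1: "1 - (norm x)\<^sup>2 > 0" by (rule one_minus_norm_sq_pos[OF x])
      \<comment> \<open>the gradient term is dominated by \<open>s\<close> times the gradient of the cutoff\<close>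
      have key: "\<bar>(1 - (norm x)\<^sup>2) * u x $ j * partial i (cutoff n) x\<bar> \<le> \<bar>C\<bar> * \<bar>s x * partial i (cutoff n) x\<bar>" for i j n
      proof -
        have "\<bar>(1 - (norm x)\<^sup>2) * u x $ j\<bar> \<le> C * s x" using bs[OF x, of j] n1 by (simp add: abs_mult mult.commute)
        also have "\<dots> \<le> \<bar>C\<bar> * s x" using sx by (intro mult_right_mono) auto
        finally have "\<bar>(1 - (norm x)\<^sup>2) * u x $ j\<bar> * \<bar>partial i (cutoff n) x\<bar> \<le> \<bar>C\<bar> * s x * \<bar>partial i (cutoff n) x\<bar>"
          by (intro mult_right_mono) auto
        then show ?thesis using sx by (simp add: abs_mult mult_ac)
      qed
      have bT: "\<bar>?T n x i j\<bar> \<le> B + \<bar>C\<bar> * (2 * K)" for n i j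
      proof -
        have "\<bar>(cutoff n x - 1) * scaled_cov_deriv u i j x\<bar> \<le> 1 * B"
          unfolding abs_mult using c01[of n x] bD[OF x, of i j] by (intro mult_mono) auto
        moreover have "\<bar>s x * partial i (cutoff n) x\<bar> \<le> 2 * K"
          using s_times_partial_cutoff_bound[of x i n] K(2)[OF x, of i] by linarith
        then have "\<bar>C\<bar> * \<bar>s x * partial i (cutoff n) x\<bar> \<le> \<bar>C\<bar> * (2 * K)" by (intro mult_left_mono) auto
        ultimately show ?thesis using key[where i = i and j = j and n = n] by linarith
      qed
      show "\<bar>?h n x\<bar> \<le> a\<^sup>2 / 4 * (4 * (B + \<bar>C\<bar> * (2 * K))\<^sup>2)" for n
      proof -
        have "?h n x \<le> a\<^sup>2 / 4 * (4 * (B + \<bar>C\<bar> * (2 * K))\<^sup>2)" by (intro mult_left_mono sum_sq_le bT) simp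
        moreover have "0 \<le> ?h n x" by (intro mult_nonneg_nonneg sum_nonneg) auto
        ultimately show ?thesis by simp
      qed
      have "(\<lambda>n. ?T n x i j) \<longlonglongrightarrow> (1 - 1) * scaled_cov_deriv u i j x + 0" for i j
      proof (intro tendsto_add tendsto_mult tendsto_diff cutoff_tendsto_1 x tendsto_const)
        have "(\<lambda>n. \<bar>C\<bar> * \<bar>s x * partial i (cutoff n) x\<bar>) \<longlonglongrightarrow> \<bar>C\<bar> * \<bar>0\<bar>"
          by (intro tendsto_intros s_times_partial_cutoff_tendsto_0 x)
        then have z: "(\<lambda>n. \<bar>C\<bar> * \<bar>s x * partial i (cutoff n) x\<bar>) \<longlonglongrightarrow> 0" by simp
        show "(\<lambda>n. (1 - (norm x)\<^sup>2) * u x $ j * partial i (cutoff n) x) \<longlonglongrightarrow> 0"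
          by (rule Lim_null_comparison[OF _ z]) (use key in auto)
      qed
      then have T0: "(\<lambda>n. ?T n x i j) \<longlonglongrightarrow> 0" for i j by simp
      have "(\<lambda>n. ?h n x) \<longlonglongrightarrow> a\<^sup>2 / 4 * (\<Sum>i\<in>(UNIV::2 set). \<Sum>j\<in>(UNIV::2 set). 0\<^sup>2)"
        by (intro tendsto_mult tendsto_sum tendsto_power T0 tendsto_const)
      then show "(\<lambda>n. ?h n x) \<longlonglongrightarrow> 0" by simp
    qed
    ultimately show ?thesis by (simp only:)
  qed
  have "(\<lambda>n. sqrt ((LINT x|vol g U. form_inner g x (?\<phi> n x - u x) (?\<phi> n x - u x))
      + (LINT x|vol g U. tensor_inner g x (cov_deriv g (?\<phi> n) x - cov_deriv g u x)
      (cov_deriv g (?\<phi> n) x - cov_deriv g u x)))) \<longlonglongrightarrow> sqrt (0 + 0)"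
    by (intro tendsto_real_sqrt tendsto_add form tensor)
  then show "(\<lambda>n. H1_norm g U (\<lambda>x. ?\<phi> n x - u x) (\<lambda>x. cov_deriv g (?\<phi> n) x - cov_deriv g u x)) \<longlonglongrightarrow> 0"
    by (simp add: H1_norm_def)
qed

end

section \<open>The flow solves the Stokes system\<close>

context exterior_flow
begin

sublocale dom: hyp_domain_boundary a exterior boundary_fun
proof unfold_locales
  show "exterior \<subseteq> hyp_plane" by (auto simp: exterior_def hyp_plane_def)
qed (simp_all add: a open_exterior smooth_boundary_fun exterior_iff_boundary_fun)

lemma exterior_punctured: "x \<in> exterior \<Longrightarrow> x \<in> punctured"
  using exterior_subset_closure exterior_closure_punctured by blast

lemma smooth_exterior: "smooth_on f punctured \<Longrightarrow> smooth_on f exterior"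
  by (rule smooth_on_subset) (auto intro: exterior_punctured)

lemma flow_bounds:
  "\<exists>B. \<forall>x\<in>exterior. (\<forall>i. \<bar>flow x $ i\<bar> \<le> B) \<and> (\<forall>i j. \<bar>dom.scaled_cov_deriv flow i j x\<bar> \<le> B)"
proof -
  have D: "smooth_on (dom.scaled_cov_deriv flow i j) punctured" for i j
  proof -
    have "smooth_on (\<lambda>x::real^2. if P then x $ i else 0) punctured" for P i
      by (cases P) (auto intro: smooth_on_intros)
    then show ?thesis unfolding dom.scaled_cov_deriv_def[abs_def]
      by (intro smooth_on_intros open_punctured smooth_flow dom.smooth_norm_sq)
  qed
  obtain C where C: "\<And>i x. x \<in> exterior \<Longrightarrow> \<bar>flow x $ i\<bar> \<le> C i"
    using bounded_on_exterior_closure[OF smooth_flow] exterior_subset_closure by (metis subsetD)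
  obtain C' where C': "\<And>i j x. x \<in> exterior \<Longrightarrow> \<bar>dom.scaled_cov_deriv flow i j x\<bar> \<le> C' i j"
    using bounded_on_exterior_closure[OF D] exterior_subset_closure by (metis subsetD)
  define B where "B = \<bar>C 1\<bar> + \<bar>C 2\<bar> + \<bar>C' 1 1\<bar> + \<bar>C' 1 2\<bar> + \<bar>C' 2 1\<bar> + \<bar>C' 2 2\<bar>"
  have "C i \<le> B" "C' i j \<le> B" for i j
    using exhaust_2[of i] exhaust_2[of j] by (auto simp: B_def)
  then show ?thesis using C C' by (meson order_trans)
qed

lemma exterior_nonempty: "exterior \<noteq> {}"
proof -
  let ?w = "of_real ((1 + k) / 2) :: complex"
  have w: "norm ?w = (1 + k) / 2" using k by (simp only: norm_of_real) simp
  then have "norm ?w < 1" using k by simp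
  then have "vector [Re (mob_inv ?w), Im (mob_inv ?w)] \<in> exterior"
    using norm_mob_inv_less_1 mob_mob_inv w k by (simp add: exterior_def flip: norm_cplx)
  then show ?thesis by blast
qed

lemma flow_not_AE_zero: "\<not> (AE x in vol (hyp_metric a) exterior. flow x = 0)"
proof
  assume "AE x in vol (hyp_metric a) exterior. flow x = 0"
  moreover have "(\<lambda>x. ennreal (inverse (inv_factor a x))) \<in> borel_measurable (lebesgue_on exterior)"
    using dom.measurable_continuous[OF dom.continuous_inv_factor] by measurable
  ultimately have "AE x in lebesgue_on exterior. 0 < ennreal (inverse (inv_factor a x)) \<longrightarrow> flow x = 0"
    unfolding vol_def vol_density_hyp_metric by (simp only: AE_density)
  then have "AE x in lebesgue. x \<in> exterior \<longrightarrow> (0 < ennreal (inverse (inv_factor a x)) \<longrightarrow> flow x = 0)"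
    using dom.U_sets by (simp add: AE_restrict_space_iff)
  then have "AE x in lebesgue. x \<notin> exterior"
    by (rule AE_mp) (auto dest: dom.inv_factor_pos_U flow_nonzero intro!: AE_I2)
  then have "exterior \<in> null_sets lebesgue" using dom.U_sets by (simp add: AE_iff_null_sets)
  then show False
    using open_not_negligible[OF open_exterior exterior_nonempty] by (simp add: negligible_iff_null_sets)
qed

lemma exterior_flow_solves_stokes:
  "flow \<in> H1_0 (hyp_metric a) exterior"
  "stokes_momentum a (hyp_metric a) exterior flow pressure"
  "weakly_coclosed (hyp_metric a) exterior flow"
  "weak_cov_deriv (hyp_metric a) exterior flow (cov_deriv (hyp_metric a) flow)"
  "L2_tensor (hyp_metric a) exterior (cov_deriv (hyp_metric a) flow)"
  "L2_loc (hyp_metric a) exterior pressure"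
proof -
  obtain B where B: "\<And>x i. x \<in> exterior \<Longrightarrow> \<bar>flow x $ i\<bar> \<le> B"
    "\<And>x i j. x \<in> exterior \<Longrightarrow> \<bar>dom.scaled_cov_deriv flow i j x\<bar> \<le> B"
    using flow_bounds by blast
  obtain C where C: "\<And>x i. x \<in> exterior \<Longrightarrow> \<bar>flow x $ i\<bar> * (1 - (norm x)\<^sup>2) \<le> C * boundary_fun x"
    using flow_vanishing_order by blast
  note u = smooth_exterior[OF smooth_flow]
  show "flow \<in> H1_0 (hyp_metric a) exterior" by (rule dom.smooth_in_H1_0[OF u B C])
  show "stokes_momentum a (hyp_metric a) exterior flow pressure"
    by (rule dom.stokes_momentum_smooth[OF u smooth_exterior[OF smooth_pressure] smooth_exterior[OF smooth_vorticity]])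
      (rule flow_divergence_free flow_curl flow_momentum, erule exterior_punctured)+
  show "weakly_coclosed (hyp_metric a) exterior flow"
    by (rule dom.weakly_coclosed_smooth[OF u flow_divergence_free[OF exterior_punctured]])
  show "weak_cov_deriv (hyp_metric a) exterior flow (cov_deriv (hyp_metric a) flow)"
    by (rule dom.weak_cov_deriv_smooth[OF u])
  show "L2_tensor (hyp_metric a) exterior (cov_deriv (hyp_metric a) flow)"
    by (rule dom.L2_tensor_cov_deriv[OF u B(2)])
  show "L2_loc (hyp_metric a) exterior pressure"
    by (rule dom.L2_loc_continuous[OF smooth_on_imp_continuous_on[OF smooth_exterior[OF smooth_pressure]]])
qed

end

theorem theorem1p2:
  fixes a R\<^sub>0 :: real and P :: "real^2"
  assumes "a > 0" and "R\<^sub>0 > 0" and "P \<in> hyp_plane"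
  defines "G \<equiv> hyp_metric a"
    and "\<Omega> \<equiv> hyp_exterior a P R\<^sub>0"
  shows "\<exists>(u :: real^2 \<Rightarrow> real^2) (p :: real^2 \<Rightarrow> real).
           u \<in> H1_0 G \<Omega> \<and>
           \<not> (AE x in vol G \<Omega>. u x = 0) \<and>
           stokes_momentum a G \<Omega> u p \<and>
           weakly_coclosed G \<Omega> u \<and>
           (\<exists>W. weak_cov_deriv G \<Omega> u W \<and> L2_tensor G \<Omega> W) \<and>
           L2_loc G \<Omega> p"
proof -
  define k where "k = tanh (a * R\<^sub>0 / 2)"
  interpret exterior_flow "cplx P" a k
    using assms by unfold_locales (auto simp: k_def hyp_plane_def tanh_real_lt_1)
  have "\<Omega> = exterior" unfolding \<Omega>_def by (rule hyp_exterior_eq_exterior[OF refl k_def])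
  then show ?thesis
    unfolding G_def using exterior_flow_solves_stokes flow_not_AE_zero by blast
qed

end
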